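(* Let $I$ be a compact non-degenerate interval and let $f\colon I\to I$ be a piecewise continuous piecewise monotone map (with finitely many pieces) whose topological entropy satisfies $h(f)=\log\beta>0$. Then there exist a map $g\in\mathcal{CS}_\beta$ (a piecewise continuous piecewise monotone map $g\colon[0,1]\to[0,1]$ of constant slope $\beta$) and an increasing continuous $f$-compatible surjection $\psi\colon I\to[0,1]$ such that $\psi$ semiconjugates $f$ with $g$, i.e. $\psi\circ f=g\circ\psi$.
   Context: "Increasing" means non-strictly increasing; "monotone" means increasing or decreasing in the non-strict sense. A map $f\colon I\to I$ is piecewise continuous piecewise monotone if $I$ can be divided into finitely many non-degenerate closed intervals, any two having at most one point in common, on the interior of each of which $f$ is continuous and monotone. The maximal intervals on which $f$ is simultaneously continuous and monotone are called laps of $f$; they are closed and non-degenerate, and if maximal intervals overlap in more than a point they are shortened so that two laps have at most one common point. For a lap $J$, $f_J\colon J\to I$ denotes the continuous monotone map equal to $f$ in the interior of $J$, with values at the endpoints given by one-sided limits. Values at points of discontinuity are irrelevant: a common endpoint of two laps may have two images, and on each lap $J$ one uses $f_J$. Iterates are formed branchwise (compositions $f_{J_{n-1}}\circ\dots\circ f_{J_0}$ where defined). Topological entropy: $h(f)=\lim_{n\to\infty}\frac1n\log c_n(f)$, where $c_n(f)$ is the number of laps of $f^n$. $\mathcal{CS}_\beta$ is the class of piecewise continuous piecewise monotone maps $g\colon[0,1]\to[0,1]$ that are piecewise affine (finitely many pieces) with $|g'(x)|=\beta$ at every $x$ where $g$ is differentiable. An increasing continuous surjection $\psi\colon I\to[0,1]$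 is $f$-compatible if, whenever $\psi$ maps a lap $J$ of $f$ to a point, it also maps the interval $f_J(J)$ to a point. Semiconjugacy: $\psi\circ f=g\circ\psi$ means that for every lap $J$ of $f$: if $\psi(J)$ is non-degenerate, there is a function $g_{\psi(J)}\colon\psi(J)\to[0,1]$ agreeing with $g$ on the interior of $\psi(J)$ (at the endpoints of $\psi(J)$ it may be another one-sided value of $g$) with $\psi(f_J(x))=g_{\psi(J)}(\psi(x))$ for all $x\in J$; if $\psi(J)$ is a point, then $\psi(f_J(J))$ is a point. *)

theory Defs
  imports "HOL-Analysis.Analysis"
begin

definition monotonic_on :: "real set \<Rightarrow> (real \<Rightarrow> real) \<Rightarrow> bool" where
  "monotonic_on A f \<longleftrightarrow> mono_on A f \<or> antimono_on A f"

(* In a division_of the members are compact intervals with pairwise disjoint interiors; for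
   non-degenerate intervals of the line this says that two of them share at most one point. *)
definition interval_division :: "real set set \<Rightarrow> real \<Rightarrow> real \<Rightarrow> bool" where
  "interval_division D a b \<longleftrightarrow> D division_of {a..b} \<and> (\<forall>J\<in>D. interior J \<noteq> {})"

definition continuous_monotone_inside :: "(real \<Rightarrow> real) \<Rightarrow> real set \<Rightarrow> bool" where
  "continuous_monotone_inside f J \<longleftrightarrow>
     continuous_on (interior J) f \<and> monotonic_on (interior J) f"

definition pc_pm_map :: "real \<Rightarrow> real \<Rightarrow> (real \<Rightarrow> real) \<Rightarrow> bool" where
  "pc_pm_map a b f \<longleftrightarrow> f \<in> {a..b} \<rightarrow> {a..b} \<and>
     (\<exists>D. interval_division D a b \<and> (\<forall>J\<in>D. continuous_monotone_inside f J))"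

definition maximal_intervals :: "real \<Rightarrow> real \<Rightarrow> (real set \<Rightarrow> bool) \<Rightarrow> real set set" where
  "maximal_intervals a b P =
     (let S = {{u..v} | u v. a \<le> u \<and> u < v \<and> v \<le> b \<and> P {u..v}}
      in {J \<in> S. \<forall>K\<in>S. J \<subseteq> K \<longrightarrow> K = J})"

(* D is a set of laps of f.  Maximal intervals may overlap in a non-degenerate interval (on which
   f is then constant), so the laps are obtained by shortening each maximal interval M J to a
   lap J; the choice of the cut points inside the overlaps is left open. *)
definition laps :: "real \<Rightarrow> real \<Rightarrow> (real \<Rightarrow> real) \<Rightarrow> real set set \<Rightarrow> bool" where
  "laps a b f D \<longleftrightarrow> interval_division D a b \<and>
     (\<exists>M. bij_betw M D (maximal_intervals a b (continuous_monotone_inside f)) \<and>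
          (\<forall>J\<in>D. J \<subseteq> M J))"

(* The map f_J; meaningful on J only. *)
definition branch :: "(real \<Rightarrow> real) \<Rightarrow> real set \<Rightarrow> real \<Rightarrow> real" where
  "branch f J x = (if x \<in> interior J then f x else Lim (at x within interior J) f)"

(* The values at x of all branch compositions f_{J_(n-1)} o ... o f_{J_0} (each J_i in D) that are
   defined at x.  There can be several, since a common endpoint of two laps has two images. *)
primrec iterate_values ::
    "(real \<Rightarrow> real) \<Rightarrow> real set set \<Rightarrow> nat \<Rightarrow> real \<Rightarrow> real set" where
  "iterate_values f D 0 x = {x}"
| "iterate_values f D (Suc n) x =
     {branch f J y | y J. y \<in> iterate_values f D n x \<and> J \<in> D \<and> y \<in> J}"

(* f^n, as a map with possibly several values at exceptional points, is continuous and monotone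
   on K: some continuous monotone function on K takes only values of f^n.  The original values of
   f at its discontinuities play no role here. *)
definition iterate_continuous_monotone ::
    "(real \<Rightarrow> real) \<Rightarrow> real set set \<Rightarrow> nat \<Rightarrow> real set \<Rightarrow> bool" where
  "iterate_continuous_monotone f D n K \<longleftrightarrow>
     (\<exists>F. continuous_on K F \<and> monotonic_on K F \<and> (\<forall>x\<in>K. F x \<in> iterate_values f D n x))"

(* Shortening overlapping maximal intervals to laps does not change their number. *)
definition lap_number ::
    "real \<Rightarrow> real \<Rightarrow> (real \<Rightarrow> real) \<Rightarrow> real set set \<Rightarrow> nat \<Rightarrow> nat" where
  "lap_number a b f D n = card (maximal_intervals a b (iterate_continuous_monotone f D n))"

definition topological_entropy ::
    "real \<Rightarrow> real \<Rightarrow> (real \<Rightarrow> real) \<Rightarrow> real set set \<Rightarrow> real" where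
  "topological_entropy a b f D = lim (\<lambda>n. ln (real (lap_number a b f D n)) / real n)"

definition constant_slope_maps :: "real \<Rightarrow> (real \<Rightarrow> real) set" where
  "constant_slope_maps \<beta> = {g. pc_pm_map 0 1 g \<and>
     (\<exists>D. interval_division D 0 1 \<and>
          (\<forall>J\<in>D. \<exists>m c. \<forall>x\<in>interior J. g x = m * x + c)) \<and>
     (\<forall>x\<in>{0..1}. \<forall>m. (g has_real_derivative m) (at x within {0..1}) \<longrightarrow> \<bar>m\<bar> = \<beta>)}"

definition compatible :: "(real \<Rightarrow> real) \<Rightarrow> real set set \<Rightarrow> (real \<Rightarrow> real) \<Rightarrow> bool" where
  "compatible f D \<psi> \<longleftrightarrow>
     (\<forall>J\<in>D. is_singleton (\<psi> ` J) \<longrightarrow> is_singleton (\<psi> ` branch f J ` J))"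

(* gJ is the map g_{psi(J)}: at an endpoint of psi(J) it takes the value of g or the one-sided
   limit of g from inside psi(J). *)
definition semiconjugates ::
    "(real \<Rightarrow> real) \<Rightarrow> (real \<Rightarrow> real) \<Rightarrow> real set set \<Rightarrow> (real \<Rightarrow> real) \<Rightarrow> bool" where
  "semiconjugates \<psi> f D g \<longleftrightarrow>
     (\<forall>J\<in>D.
        (\<not> is_singleton (\<psi> ` J) \<longrightarrow>
           (\<exists>gJ. gJ \<in> \<psi> ` J \<rightarrow> {0..1} \<and>
                 (\<forall>y\<in>interior (\<psi> ` J). gJ y = g y) \<and>
                 (\<forall>y\<in>\<psi> ` J. gJ y = g y \<or> (g \<longlongrightarrow> gJ y) (at y within interior (\<psi> ` J))) \<and>
                 (\<forall>x\<in>J. \<psi> (branch f J x) = gJ (\<psi> x)))) \<and>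
        (is_singleton (\<psi> ` J) \<longrightarrow> is_singleton (\<psi> ` branch f J ` J)))"

end

(* Let count n K be the least number of intervals into which K can be cut so that f^n is continuous
   and monotone on each.  Up to an error of 1, count n is additive in K, and count (n + 1) K equals
   count n (f K) when K lies in a lap.  On [a, b] the counts are submultiplicative up to a shift by 1
   and differ from the lap numbers by a factor linear in n, so they grow like beta^n and the
   generating function L(t, K) = sum_n count n K t^n diverges at t = 1/beta.  After division by
   L(t, [a, b]) the bounded errors vanish as t -> 1/beta, so any pointwise limit psi(x) of
   L(t, [a, x]) / L(t, [a, b]) (Milnor and Thurston) satisfies
   |psi(f_J x) - psi(f_J y)| = beta |psi x - psi y| on each lap J.  Iterating this relation, the
   oscillation of psi near a point is at most beta^(-n) for every n, so psi is continuous, and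
   psi o f_J is an affine function of psi with slope beta or -beta, which defines g. *)
theory Submission
  imports Defs "HOL-Real_Asymp.Real_Asymp"
begin

text \<open>Lap numbers count maximal intervals, which may overlap and which behave badly under
  restriction and composition; least numbers of pieces behave well, so lap numbers enter only to
  read off the growth rate. That comparison rests on two facts about the many-valued iterates. The
  graph of all values of \<open>f^n\<close> is compact, so limits of continuous monotone selections
  are again selections and maximal intervals exist. The number of values at a point grows at most
  linearly in n, which limits how many maximal intervals pass through it. Closedness of the graph
  also settles the endpoints of laps, where f has two images. The errors of size 1 in the counts sum
  to 1/(1 - t), which stays bounded at t = 1/beta because beta > 1. Divergence of the generating
  function there needs more than the growth rate: Fekete's lemma supplies beta^n <= 1 + count n
  [a, b] for every n. That count n (f K) is at most count (n + 1) K is not a matter of composition: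
  a selection of \<open>f^(n+1)\<close> has to be factored through a branch that may be constant on
  intervals.\<close>

subsection \<open>Limits\<close>

text \<open>Tychonoff: the functions \<open>\<Psi> i\<close> lie in a compact product of intervals,
  and \<open>G\<close> is obtained by pulling back the neighbourhoods of a cluster point. A finer
  filter takes the place of a subsequence, since convergence is wanted at possibly uncountably many
  points at once.\<close>

lemma convergent_refinement:
  fixes \<Psi> :: "'i \<Rightarrow> 'x \<Rightarrow> real"
  assumes H: "H \<noteq> bot" and bd: "\<And>i x. \<Psi> i x \<in> {l..r}"
  obtains G \<psi> where "G \<noteq> bot" "G \<le> H" "\<And>x. ((\<lambda>i. \<Psi> i x) \<longlongrightarrow> \<psi> x) G"
proof -
  let ?U = "PiE UNIV (\<lambda>_::'x. {l..r})"
  have "compactin (product_topology (\<lambda>_::'x. euclidean) UNIV) ?U"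
    unfolding compactin_PiE by simp
  then have "compact ?U"
    by (simp add: euclidean_product_topology)
  moreover have "filtermap \<Psi> H \<noteq> bot"
    using H by (simp add: filtermap_bot_iff)
  moreover have "eventually (\<lambda>x. x \<in> ?U) (filtermap \<Psi> H)"
    using bd by (simp add: eventually_filtermap PiE_UNIV_domain)
  ultimately obtain \<psi> where \<psi>: "inf (nhds \<psi>) (filtermap \<Psi> H) \<noteq> bot"
    unfolding compact_filter by blast
  define G where "G = inf (filtercomap \<Psi> (nhds \<psi>)) H"
  have "filterlim \<Psi> (nhds \<psi>) G"
    unfolding filterlim_def G_def
    by (metis filtermap_filtercomap filtermap_mono inf.cobounded1 order_trans)
  then have "((\<lambda>i. \<Psi> i x) \<longlongrightarrow> \<psi> x) G" for x
    using continuous_on_tendsto_compose[OF continuous_on_product_coordinates[of x]] by auto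
  \<comment> \<open>If \<open>G\<close> were trivial, some neighbourhood of the cluster point would
    eventually be avoided along \<open>H\<close>.\<close>
  moreover have "G \<noteq> bot"
  proof
    assume "G = bot"
    then obtain P Q where PQ: "eventually P (nhds \<psi>)" "eventually Q H"
        "\<And>i. P (\<Psi> i) \<Longrightarrow> Q i \<Longrightarrow> False"
      unfolding G_def trivial_limit_def eventually_inf eventually_filtercomap by blast
    from PQ(2) have "eventually (\<lambda>i. \<not> P (\<Psi> i)) H"
      by (rule eventually_mono) (use PQ(3) in blast)
    with PQ(1) have "eventually (\<lambda>_. False) (inf (nhds \<psi>) (filtermap \<Psi> H))"
      unfolding eventually_inf eventually_filtermap
      by (intro exI[of _ P] exI[of _ "\<lambda>y. \<not> P y"]) auto
    with \<psi> show False
      by (simp add: trivial_limit_def)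
  qed
  moreover have "G \<le> H"
    by (simp add: G_def)
  ultimately show ?thesis
    using that by blast
qed

text \<open>Fekete's lemma. The limit is the infimum of the averages, which gives the bound for
  every single \<open>n\<close> as well; \<open>count_ge\<close> depends on that bound.\<close>

lemma subadditive_average_converges:
  fixes s :: "nat \<Rightarrow> real"
  assumes nonneg: "\<And>n. 0 \<le> s n" and sub: "\<And>m n. s (m + n) \<le> s m + s n"
  obtains L where "(\<lambda>n. s n / n) \<longlonglongrightarrow> L" "\<And>n. 0 < n \<Longrightarrow> L * n \<le> s n"
proof -
  define L where "L = (INF n\<in>{0<..}. s n / real n)"
  have bdd: "bdd_below ((\<lambda>n. s n / real n) ` {0<..})"
    using nonneg by (intro bdd_belowI[of _ 0]) auto
  have le: "L \<le> s n / n" if "0 < n" for n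
    unfolding L_def using that by (intro cINF_lower[OF bdd]) auto
  have mult: "s (q * m) \<le> q * s m + s 0" for q m
  proof (induction q)
    case (Suc q)
    then show ?case
      using sub[of m "q * m"] by (simp add: algebra_simps)
  qed simp
  have "(\<lambda>n. s n / n) \<longlonglongrightarrow> L"
  proof (rule LIMSEQ_I)
    fix e :: real
    assume e: "0 < e"
    have "L < L + e / 2" using e by simp
    then obtain m where m: "0 < m" "s m / m < L + e / 2"
      unfolding L_def by (subst (asm) cINF_less_iff[OF _ bdd]) auto
    \<comment> \<open>Division by \<open>m\<close> leaves the value at the remainder and one
      \<open>s 0\<close> coming from \<open>mult\<close>; \<open>C\<close> bounds their sum for all
      remainders.\<close>
    define C where "C = Max (s ` {..<m}) + s 0"
    have C: "s r + s 0 \<le> C" if "r < m" for r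
      using that unfolding C_def by (auto intro!: Max_ge)
    have up: "s n / n \<le> L + e / 2 + C / n" if "0 < n" for n
    proof -
      have "s n \<le> s (n div m * m) + s (n mod m)"
        using sub[of "n div m * m" "n mod m"] by simp
      also have "\<dots> \<le> (n div m) * s m + C"
        using mult[of "n div m" m] C[of "n mod m"] m by simp
      also have "(n div m) * s m = real (n div m * m) * (s m / m)"
        using m by simp
      also have "\<dots> \<le> n * (s m / m)"
        using nonneg[of m] by (intro mult_right_mono) (auto simp del: of_nat_mult)
      also have "\<dots> \<le> n * (L + e / 2)"
        using m by (intro mult_left_mono) auto
      finally show ?thesis
        using that by (simp add: field_simps)
    qed
    have "(\<lambda>n. C / real n) \<longlonglongrightarrow> 0"
      by (rule lim_const_over_n)
    then have "eventually (\<lambda>n. C / real n < e / 2) sequentially"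
      using e by (intro order_tendstoD) auto
    then obtain N where N: "\<And>n. n \<ge> N \<Longrightarrow> C / real n < e / 2"
      by (auto simp: eventually_sequentially)
    show "\<exists>no. \<forall>n\<ge>no. norm (s n / n - L) < e"
    proof (intro exI allI impI)
      fix n assume n: "n \<ge> Suc N"
      then have "0 < n" "n \<ge> N" by auto
      then show "norm (s n / n - L) < e"
        unfolding real_norm_def using le[of n] up[of n] N[of n] e by arith
    qed
  qed
  moreover have "L * n \<le> s n" if "0 < n" for n
    using le[OF that] that by (simp add: field_simps)
  ultimately show ?thesis using that by blast
qed

subsection \<open>Cutting an interval into pieces\<close>

text \<open>Pieces may be degenerate, but only a degenerate interval is cut into \<open>0\<close> pieces.\<close>

primrec splits :: "(real set \<Rightarrow> bool) \<Rightarrow> nat \<Rightarrow> real \<Rightarrow> real \<Rightarrow> bool" where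
  "splits P 0 u w \<longleftrightarrow> u = w"
| "splits P (Suc N) u w \<longleftrightarrow> (\<exists>v. u \<le> v \<and> v \<le> w \<and> P {u..v} \<and> splits P N v w)"

lemma splits_le: "splits P N u w \<Longrightarrow> u \<le> w"
  by (induction N arbitrary: u) (simp, meson order_trans splits.simps(2))

lemma splits_append: "splits P M u v \<Longrightarrow> splits P N v w \<Longrightarrow> splits P (M + N) u w"
  by (induction M arbitrary: u) (auto, meson order_trans splits_le)

lemma splits_one: "splits P (Suc 0) u w \<longleftrightarrow> u \<le> w \<and> P {u..w}"
  by auto

lemma splits_mono:
  assumes "splits P N u w" "N \<le> N'" "P {w}"
  shows "splits P N' u w"
proof -
  have "splits P k w w" for k
    by (induction k) (use assms in auto)
  then show ?thesis
    using splits_append[OF assms(1), of "N' - N" w] assms(2) by simp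
qed

text \<open>Only the piece that contains \<open>v\<close> has to be cut in two, which costs the
  additional 1.\<close>

lemma splits_cut:
  assumes sub: "\<And>p q p' q'. P {p..q} \<Longrightarrow> p \<le> p' \<Longrightarrow> p' \<le> q' \<Longrightarrow> q' \<le> q \<Longrightarrow> P {p'..q'}"
  shows "splits P N u w \<Longrightarrow> u \<le> v \<Longrightarrow> v \<le> w \<Longrightarrow>
    \<exists>M M'. M + M' \<le> Suc N \<and> splits P M u v \<and> splits P M' v w"
proof (induction N arbitrary: u)
  case 0
  then show ?case by (intro exI[of _ 0]) auto
next
  case (Suc N)
  then obtain z where z: "u \<le> z" "z \<le> w" "P {u..z}" "splits P N z w" by auto
  show ?case
  proof (cases "v \<le> z")
    case True
    then have "P {u..v}" "P {v..z}"
      using Suc.prems z sub by auto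
    then have "splits P (Suc 0) u v" "splits P (Suc N) v w"
      using True z Suc.prems by auto
    then show ?thesis
      by (intro exI[of _ "Suc 0"] exI[of _ "Suc N"]) auto
  next
    case False
    then obtain M M' where "M + M' \<le> Suc N" "splits P M z v" "splits P M' v w"
      using Suc z by (meson linorder_not_less less_imp_le)
    then show ?thesis
      using z False by (intro exI[of _ "Suc M"] exI[of _ M']) auto
  qed
qed

lemma splits_nondegenerate_piece:
  "splits P N u w \<Longrightarrow> u < w \<Longrightarrow> x \<in> {u..w} \<Longrightarrow>
    \<exists>p q. u \<le> p \<and> p < q \<and> q \<le> w \<and> x \<in> {p..q} \<and> P {p..q}"
proof (induction N arbitrary: u)
  case (Suc N)
  then obtain v where v: "u \<le> v" "v \<le> w" "P {u..v}" "splits P N v w" by auto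
  show ?case
  proof (cases "u < v \<and> x \<le> v")
    case True
    then show ?thesis using v Suc.prems by auto
  next
    case False
    then have "v < w" "x \<in> {v..w}"
      using v Suc.prems by auto
    from Suc.IH[OF v(4) this] show ?thesis
      using v by (meson order_trans)
  qed
qed simp

text \<open>\<open>R\<close> consists of the cut points, both ends included. The inequalities at
  \<open>p\<close> and \<open>q\<close> are strict so that an interval avoiding \<open>R\<close> can
  be enlarged, which is impossible for a maximal one.\<close>

lemma splits_endpoints:
  "splits P N u w \<Longrightarrow> \<exists>R. finite R \<and> card R \<le> Suc N \<and> R \<subseteq> {u..w} \<and> u \<in> R \<and>
    (\<forall>s t. u \<le> s \<longrightarrow> s \<le> t \<longrightarrow> t \<le> w \<longrightarrow> {s..t} \<inter> R = {} \<longrightarrow>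
      (\<exists>p q. u \<le> p \<and> p < s \<and> t < q \<and> q \<le> w \<and> P {p..q}))"
proof (induction N arbitrary: u)
  case 0
  then show ?case by (intro exI[of _ "{u}"]) auto
next
  case (Suc N)
  then obtain v where v: "u \<le> v" "v \<le> w" "P {u..v}" "splits P N v w" by auto
  obtain R where R: "finite R" "card R \<le> Suc N" "R \<subseteq> {v..w}" "v \<in> R"
    "\<And>s t. v \<le> s \<Longrightarrow> s \<le> t \<Longrightarrow> t \<le> w \<Longrightarrow> {s..t} \<inter> R = {} \<Longrightarrow>
      \<exists>p q. v \<le> p \<and> p < s \<and> t < q \<and> q \<le> w \<and> P {p..q}"
    using Suc.IH[OF v(4)] by blast
  have "\<exists>p q. u \<le> p \<and> p < s \<and> t < q \<and> q \<le> w \<and> P {p..q}"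
    if st: "u \<le> s" "s \<le> t" "t \<le> w" "{s..t} \<inter> insert u R = {}" for s t
  proof (cases "t < v")
    case True
    moreover have "u < s" using st by (cases "u = s") auto
    ultimately show ?thesis using v by blast
  next
    case False
    moreover have "v \<notin> {s..t}" using R(4) st by blast
    ultimately have "v \<le> s" by auto
    then show ?thesis
      using R(5)[of s t] st v by (meson disjoint_insert(1) order_trans)
  qed
  then show ?case
    using R(1-3) v card_insert_le_m1[of "Suc (Suc N)" R u]
    by (intro exI[of _ "insert u R"]) auto
qed

text \<open>Greedy choice: among the members that contain the left end, take one that reaches
  farthest to the right, and continue from its right end with the others.\<close>

lemma splits_of_cover:
  assumes "finite S" "\<And>K. K \<in> S \<Longrightarrow> P K \<and> (\<exists>p q. p \<le> q \<and> K = {p..q})"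
    and sub: "\<And>p q p' q'. P {p..q} \<Longrightarrow> p \<le> p' \<Longrightarrow> p' \<le> q' \<Longrightarrow> q' \<le> q \<Longrightarrow> P {p'..q'}"
  shows "u \<le> w \<Longrightarrow> {u..w} \<subseteq> \<Union>S \<Longrightarrow> \<exists>N\<le>card S. splits P N u w"
  using assms(1,2)
proof (induction "card S" arbitrary: S u)
  case 0
  then show ?case by auto
next
  case (Suc k)
  let ?A = "{K \<in> S. u \<in> K}"
  have A: "finite ?A" "?A \<noteq> {}"
    using Suc.prems by auto
  have "Max (Sup ` ?A) \<in> Sup ` ?A"
    using A by (intro Max_in) auto
  then obtain K where K: "K \<in> ?A" "Max (Sup ` ?A) = Sup K" by blast
  have max: "Sup K' \<le> Sup K" if "K' \<in> ?A" for K'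
    using Max_ge[of "Sup ` ?A" "Sup K'"] A that K(2) by simp
  obtain p v where "p \<le> v" "K = {p..v}" "P {p..v}"
    using Suc.prems(4)[of K] K(1) by auto
  then have pv: "p \<le> v" "K = {p..v}" "P {p..v}" "p \<le> u" "u \<le> v"
    using K(1) by auto
  show ?case
  proof (cases "w \<le> v")
    case True
    then have "splits P (Suc 0) u w"
      using sub[OF pv(3,4), of w] Suc.prems(1) unfolding splits_one by simp
    then show ?thesis
      using Suc.hyps(2) by (metis Suc_le_mono le0)
  next
    case False
    let ?S = "S - {K}"
    \<comment> \<open>The other members need not obviously contain \<open>v\<close> itself; this
      follows afterwards because their union is closed.\<close>
    have "{v<..<w} \<subseteq> \<Union>?S"
    proof
      fix x assume x: "x \<in> {v<..<w}"
      then have "x \<in> {u..w}" using pv by auto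
      then obtain K' where K': "K' \<in> S" "x \<in> K'" using Suc.prems(2) by blast
      then have "K' \<noteq> K" using x pv by auto
      then show "x \<in> \<Union>?S" using K' by blast
    qed
    moreover have "closed (\<Union>?S)"
      using Suc.prems(3,4) by (intro closed_Union) auto
    ultimately have "closure {v<..<w} \<subseteq> \<Union>?S"
      by (intro closure_minimal)
    then have "{v..w} \<subseteq> \<Union>?S"
      using False by simp
    moreover have k: "k = card ?S"
      using Suc.hyps(2) K Suc.prems(3) by simp
    moreover have "finite ?S" "v \<le> w" using Suc.prems(3) False by auto
    moreover have "P K' \<and> (\<exists>p q. p \<le> q \<and> K' = {p..q})" if "K' \<in> ?S" for K'
      using Suc.prems(4) that by simp
    ultimately obtain N where N: "N \<le> card ?S" "splits P N v w"
      using Suc.hyps(1)[of ?S v] by blast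
    have "P {u..v}" using sub[OF pv(3,4,5)] by simp
    then have "splits P (Suc N) u w" "Suc N \<le> card S"
      using pv False N k Suc.hyps(2) by auto
    then show ?thesis by blast
  qed
qed

text \<open>For the properties \<open>P n\<close> and subintervals of \<open>[a, b]\<close> a
  splitting always exists (\<open>splits_exists\<close>), so there the \<open>LEAST\<close> is
  attained.\<close>

definition pieces :: "(real set \<Rightarrow> bool) \<Rightarrow> real \<Rightarrow> real \<Rightarrow> nat" where
  "pieces P u w = (LEAST N. splits P N u w)"

lemma splits_pieces: "splits P N u w \<Longrightarrow> splits P (pieces P u w) u w"
  unfolding pieces_def by (rule LeastI)

lemma pieces_le: "splits P N u w \<Longrightarrow> pieces P u w \<le> N"
  unfolding pieces_def by (rule Least_le)

lemma pieces_self [simp]: "pieces P u u = 0"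
  using pieces_le[of P 0 u u] by simp

text \<open>Boundedness yields the one-sided limits as an infimum and a supremum; they are the
  values that \<open>branch\<close> takes at the endpoints of a lap.\<close>

lemma monotone_extends_to_closure:
  fixes f :: "real \<Rightarrow> real"
  assumes "u < v" and cont: "continuous_on {u<..<v} f" and mono: "mono_on {u<..<v} f"
    and bd: "f ` {u<..<v} \<subseteq> {l..r}"
  obtains F where "continuous_on {u..v} F" "mono_on {u..v} F" "F ` {u..v} \<subseteq> {l..r}"
    "\<And>x. x \<in> {u<..<v} \<Longrightarrow> F x = f x"
proof -
  have bd': "l \<le> f x" "f x \<le> r" if "u < x" "x < v" for x
    using bd that by (simp_all add: image_subset_iff)
  have "(f \<longlongrightarrow> Inf (f ` ({u<..} \<inter> {u<..<v}))) (at u within ({u<..} \<inter> {u<..<v}))"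
    using mono by (intro Lim_right_bound[where K = l]) (auto simp: monotone_on_def intro: bd')
  moreover have "{u<..} \<inter> {u<..<v} = {u<..<v}" "at u within {u<..<v} = at_right u"
    using assms(1) by (auto intro!: at_within_nhd[of u "{..<v}"])
  ultimately obtain p where p: "(f \<longlongrightarrow> p) (at_right u)" by metis
  have "(f \<longlongrightarrow> Sup (f ` ({..<v} \<inter> {u<..<v}))) (at v within ({..<v} \<inter> {u<..<v}))"
    using mono by (intro Lim_left_bound[where K = r]) (auto simp: monotone_on_def intro: bd')
  moreover have "{..<v} \<inter> {u<..<v} = {u<..<v}" "at v within {u<..<v} = at_left v"
    using assms(1) by (auto intro!: at_within_nhd[of v "{u<..}"])
  ultimately obtain q where q: "(f \<longlongrightarrow> q) (at_left v)" by metis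
  have ev: "eventually (\<lambda>y. y \<in> {u<..<x}) (at_right u)" "eventually (\<lambda>y. y \<in> {x<..<v}) (at_left v)"
    if "x \<in> {u<..<v}" for x
    using that eventually_at_right_field[of _ u] eventually_at_left_field[of _ v] by auto
  have below: "p \<le> f x" and above: "f x \<le> q" if x: "x \<in> {u<..<v}" for x
  proof -
    have "eventually (\<lambda>y. f y \<le> f x) (at_right u)"
      by (rule eventually_mono[OF ev(1)[OF x]]) (use x mono in \<open>auto simp: monotone_on_def\<close>)
    then show "p \<le> f x"
      using p by (intro tendsto_upperbound) auto
    have "eventually (\<lambda>y. f x \<le> f y) (at_left v)"
      by (rule eventually_mono[OF ev(2)[OF x]]) (use x mono in \<open>auto simp: monotone_on_def\<close>)
    then show "f x \<le> q"
      using q by (intro tendsto_lowerbound) auto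
  qed
  have m: "(u + v) / 2 \<in> {u<..<v}" using assms(1) by auto
  have ran: "p \<in> {l..r}" "q \<in> {l..r}"
  proof -
    have "eventually (\<lambda>y. f y \<in> {l..r}) (at_right u)"
      by (rule eventually_mono[OF ev(1)[OF m]]) (use bd' in auto)
    then show "p \<in> {l..r}"
      using p by (intro Lim_in_closed_set[of "{l..r}" f]) auto
    have "eventually (\<lambda>y. f y \<in> {l..r}) (at_left v)"
      by (rule eventually_mono[OF ev(2)[OF m]]) (use bd' in auto)
    then show "q \<in> {l..r}"
      using q by (intro Lim_in_closed_set[of "{l..r}" f]) auto
  qed
  define F where "F x = (if x \<le> u then p else if v \<le> x then q else f x)" for x
  have pq: "p \<le> q"
    using below[OF m] above[OF m] by simp
  have "continuous_on {u..v} F"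
  proof (rule continuous_on_IccI)
    have "eventually (\<lambda>y. F y = f y) (at_right u)" "eventually (\<lambda>y. F y = f y) (at_left v)"
      by (rule eventually_mono[OF ev(1)[OF m]], simp add: F_def)
        (rule eventually_mono[OF ev(2)[OF m]], simp add: F_def)
    then show "(F \<longlongrightarrow> F u) (at_right u)" "(F \<longlongrightarrow> F v) (at_left v)"
      using p q assms(1) by (auto simp: tendsto_cong F_def)
    fix x assume x: "u < x" "x < v"
    then have "eventually (\<lambda>y. y \<in> {u<..<v}) (at x)"
      by (intro eventually_at_in_open') auto
    then have "eventually (\<lambda>y. F y = f y) (at x)"
      by eventually_elim (simp add: F_def)
    moreover have "(f \<longlongrightarrow> f x) (at x)"
      using cont x by (simp add: continuous_on_eq_continuous_at isCont_def)
    ultimately show "(F \<longlongrightarrow> F x) (at x)"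
      using x by (simp add: tendsto_cong F_def)
  qed fact
  moreover have "mono_on {u..v} F"
    using below above pq mono by (intro monotone_onI) (simp add: F_def monotone_on_def not_le)
  moreover have "F ` {u..v} \<subseteq> {l..r}"
    using ran bd' by (simp add: F_def image_subset_iff)
  moreover have "F x = f x" if "x \<in> {u<..<v}" for x
    using that by (simp add: F_def)
  ultimately show ?thesis using that by blast
qed

subsection \<open>Laps, branches and values of iterates\<close>

text \<open>A direction is represented by the order relation itself, so that increasing and
  decreasing maps can share statements and proofs.\<close>

abbreviation directed :: "(real \<Rightarrow> real \<Rightarrow> bool) \<Rightarrow> bool" where
  "directed R \<equiv> R = (\<le>) \<or> R = (\<ge>)"

lemma monotonic_on_iff: "monotonic_on K F \<longleftrightarrow> (\<exists>R. directed R \<and> monotone_on K (\<le>) R F)"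
  unfolding monotonic_on_def by auto

lemma directed_order:
  assumes "directed R"
  shows "R x x" "R x y \<Longrightarrow> R y z \<Longrightarrow> R x z"
  using assms by auto

lemma monotonic_extends_to_closure:
  fixes f :: "real \<Rightarrow> real"
  assumes "u < v" "continuous_on {u<..<v} f" "monotonic_on {u<..<v} f"
    and bd: "f ` {u<..<v} \<subseteq> {l..r}"
  obtains F where "continuous_on {u..v} F" "monotonic_on {u..v} F" "F ` {u..v} \<subseteq> {l..r}"
    "\<And>x. x \<in> {u<..<v} \<Longrightarrow> F x = f x"
proof -
  from assms(3) consider "mono_on {u<..<v} f" | "antimono_on {u<..<v} f"
    unfolding monotonic_on_def by blast
  then show ?thesis
  proof cases
    case 1
    then show ?thesis
      using monotone_extends_to_closure[OF assms(1,2) _ bd] that by (metis monotonic_on_def)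
  next
    case 2
    have "(\<lambda>x. - f x) ` {u<..<v} \<subseteq> {- r..- l}" using bd by (simp add: image_subset_iff)
    moreover have "mono_on {u<..<v} (\<lambda>x. - f x)" using 2 by (simp add: monotone_on_def)
    ultimately obtain F where F: "continuous_on {u..v} F" "mono_on {u..v} F"
        "F ` {u..v} \<subseteq> {- r..- l}" "\<And>x. x \<in> {u<..<v} \<Longrightarrow> F x = - f x"
      using monotone_extends_to_closure[OF assms(1), of "\<lambda>x. - f x"] assms(2)
      by (metis continuous_on_minus)
    have "antimono_on {u..v} (\<lambda>x. - F x)" using F(2) by (simp add: monotone_on_def)
    moreover have "- F x = f x" if "x \<in> {u<..<v}" for x using F(4)[OF that] by simp
    moreover have "(\<lambda>x. - F x) ` {u..v} \<subseteq> {l..r}" using F(3) by (force simp: image_subset_iff)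
    ultimately show ?thesis
      using that[of "\<lambda>x. - F x"] F(1) by (simp add: monotonic_on_def continuous_on_minus)
  qed
qed

locale piecewise_monotone =
  fixes a b :: real and f :: "real \<Rightarrow> real" and D :: "real set set"
  assumes ab: "a < b"
    and f_range: "f \<in> {a..b} \<rightarrow> {a..b}"
    and division: "interval_division D a b"
    and on_lap: "J \<in> D \<Longrightarrow> continuous_monotone_inside f J"
begin

lemma finite_D: "finite D"
  using division by (auto simp: interval_division_def division_of_def)

lemma cover: "\<Union>D = {a..b}"
  using division by (auto simp: interval_division_def division_of_def)

lemma lap_interval:
  assumes "J \<in> D"
  obtains u v where "J = {u..v}" "u < v" "a \<le> u" "v \<le> b"
proof -
  obtain u v where J: "J = {u..v}"
    using division assms by (force simp: interval_division_def division_of_def)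
  moreover have "interior J \<noteq> {}"
    using division assms by (auto simp: interval_division_def)
  ultimately have "u < v" by auto
  moreover have "J \<subseteq> {a..b}" using cover assms by auto
  ultimately show ?thesis using that J by auto
qed

lemma lap_subset: "J \<in> D \<Longrightarrow> J \<subseteq> {a..b}"
  using cover by auto

lemma laps_disjoint: "J \<in> D \<Longrightarrow> J' \<in> D \<Longrightarrow> J \<noteq> J' \<Longrightarrow> interior J \<inter> interior J' = {}"
  using division by (auto simp: interval_division_def division_of_def)

text \<open>The open set \<open>interior J\<close> misses \<open>interior J'\<close> and hence also
  its closure, which is \<open>J'\<close> because laps are non-degenerate.\<close>

lemma lap_unique:
  assumes "J \<in> D" "J' \<in> D" "t \<in> interior J" "t \<in> J'"
  shows "J' = J"
proof (rule ccontr)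
  assume "J' \<noteq> J"
  then have "interior J \<inter> interior J' = {}" using laps_disjoint assms by blast
  then have "interior J \<inter> closure (interior J') = {}"
    by (simp add: open_Int_closure_eq_empty)
  moreover obtain u v where "J' = {u..v}" "u < v"
    using lap_interval[OF assms(2)] by metis
  then have "closure (interior J') = J'" by simp
  ultimately show False using assms by auto
qed

text \<open>On \<open>J\<close> the branch coincides with the continuous extension of
  \<open>f\<close> from the interior, so all three properties are inherited from the
  extension.\<close>

lemma branch_props:
  assumes "J \<in> D"
  shows branch_continuous: "continuous_on J (branch f J)"
    and branch_monotonic: "monotonic_on J (branch f J)"
    and branch_range: "branch f J ` J \<subseteq> {a..b}"
proof -
  obtain u v where J: "J = {u..v}" "u < v" "a \<le> u" "v \<le> b"
    using lap_interval[OF assms] .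
  have i: "interior J = {u<..<v}" using J by simp
  have "continuous_on {u<..<v} f" "monotonic_on {u<..<v} f"
    using on_lap[OF assms] unfolding continuous_monotone_inside_def i by auto
  moreover have "f ` {u<..<v} \<subseteq> {a..b}" using f_range J by (auto simp: Pi_iff)
  ultimately obtain F where F: "continuous_on {u..v} F" "monotonic_on {u..v} F" "F ` {u..v} \<subseteq> {a..b}"
      "\<And>x. x \<in> {u<..<v} \<Longrightarrow> F x = f x"
    using monotonic_extends_to_closure[OF J(2)] by metis
  have eq: "branch f J x = F x" if x: "x \<in> {u..v}" for x
  proof (cases "x \<in> {u<..<v}")
    case True
    then show ?thesis using F(4) by (simp add: branch_def i)
  next
    case False
    have "(F \<longlongrightarrow> F x) (at x within {u<..<v})"
      using F(1) x by (meson continuous_on_def greaterThanLessThan_subseteq_atLeastAtMost_iff order_refl tendsto_within_subset)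
    then have "(f \<longlongrightarrow> F x) (at x within {u<..<v})"
      using F(4) by (auto elim!: Lim_transform_within[where d = 1])
    moreover have "at x within {u<..<v} \<noteq> bot"
    proof -
      have "x \<in> closure {u<..<v}" using x J by simp
      then show ?thesis
        using False by (auto simp: trivial_limit_within closure_def)
    qed
    ultimately have "Lim (at x within {u<..<v}) f = F x"
      by (intro tendsto_Lim)
    then show ?thesis
      using False by (simp only: branch_def i if_False)
  qed
  show "continuous_on J (branch f J)"
    using F(1) eq J(1) continuous_on_cong[of J J "branch f J" F] by simp
  show "monotonic_on J (branch f J)"
    using F(2) eq J(1) by (simp add: monotonic_on_def monotone_on_def)
  show "branch f J ` J \<subseteq> {a..b}"
    using F(3) eq J(1) by auto
qed

section \<open>Values of the many-valued iterates\<close>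

abbreviation V :: "nat \<Rightarrow> real \<Rightarrow> real set" where
  "V n x \<equiv> iterate_values f D n x"

lemma V_Suc: "V (Suc n) x = (\<Union>y\<in>V n x. \<Union>J\<in>{J\<in>D. y \<in> J}. {branch f J y})"
  by auto

declare iterate_values.simps(2) [simp del]

lemma V_add: "V (m + n) x = (\<Union>y\<in>V m x. V n y)"
  by (induction n) (auto simp: V_Suc)

text \<open>The definition appends a branch at the end; comparing \<open>f^(n+1)\<close> on an
  interval with \<open>f^n\<close> on its image requires peeling off the first branch
  instead.\<close>

lemma V_Suc_left: "V (Suc n) x = (\<Union>J\<in>{J\<in>D. x \<in> J}. V n (branch f J x))"
  using V_add[of "Suc 0" n x] by (auto simp: V_Suc)

lemma V_range: "x \<in> {a..b} \<Longrightarrow> V n x \<subseteq> {a..b}"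
proof (induction n)
  case (Suc n)
  then show ?case using branch_range by (fastforce simp: V_Suc)
qed auto

lemma V_nonempty: "x \<in> {a..b} \<Longrightarrow> V n x \<noteq> {}"
proof (induction n)
  case (Suc n)
  then obtain y where "y \<in> V n x" by auto
  moreover from this obtain J where "J \<in> D" "y \<in> J"
    using V_range[OF Suc.prems, of n] cover by blast
  ultimately show ?case by (auto simp: V_Suc)
qed simp

lemma V_finite: "finite (V n x)"
  by (induction n) (auto simp: V_Suc finite_D)

definition endpoint_values :: "real set" where
  "endpoint_values = {branch f J y | J y. J \<in> D \<and> y \<in> J - interior J}"

lemma finite_endpoint_values: "finite endpoint_values"
proof -
  have "finite (J - interior J)" if "J \<in> D" for J
  proof -
    obtain u v where "J = {u..v}" "u < v" using lap_interval[OF \<open>J \<in> D\<close>] by metis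
    then have "J - interior J \<subseteq> {u, v}" by auto
    then show ?thesis by (rule finite_subset) simp
  qed
  then have "finite (\<Union>J\<in>D. branch f J ` (J - interior J))"
    using finite_D by blast
  moreover have "endpoint_values = (\<Union>J\<in>D. branch f J ` (J - interior J))"
    by (auto simp: endpoint_values_def)
  ultimately show ?thesis by simp
qed

text \<open>Away from the endpoints of laps a point has one image, so in each step the number of values
  grows at most by the number of images of endpoints.\<close>

lemma card_V_le: "card (V n x) \<le> 1 + n * card endpoint_values"
proof (induction n)
  case (Suc n)
  have "V (Suc n) x \<subseteq> f ` V n x \<union> endpoint_values"
    by (auto simp: V_Suc endpoint_values_def branch_def) blast
  then have "card (V (Suc n) x) \<le> card (f ` V n x \<union> endpoint_values)"
    by (intro card_mono) (auto simp: V_finite finite_endpoint_values)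
  also have "\<dots> \<le> card (f ` V n x) + card endpoint_values"
    by (rule card_Un_le)
  also have "card (f ` V n x) \<le> card (V n x)"
    by (rule card_image_le[OF V_finite])
  finally show ?case using Suc by simp
qed simp

definition value_graph :: "nat \<Rightarrow> (real \<times> real) set" where
  "value_graph n = {(x, y). x \<in> {a..b} \<and> y \<in> V n x}"

text \<open>The next graph is a finite union of continuous images of compact sets, because each
  branch is applied on its own closed lap, endpoints included.\<close>

lemma compact_value_graph: "compact (value_graph n)"
proof (induction n)
  case 0
  have "value_graph 0 = (\<lambda>x. (x, x)) ` {a..b}"
    by (auto simp: value_graph_def)
  then show ?case by (auto intro!: compact_continuous_image continuous_intros)
next
  case (Suc n)
  have eq: "value_graph (Suc n) =
      (\<Union>J\<in>D. (\<lambda>p. (fst p, branch f J (snd p))) ` (value_graph n \<inter> UNIV \<times> J))"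
  proof (intro equalityI subsetI)
    fix z assume "z \<in> value_graph (Suc n)"
    then obtain x y J where "z = (x, branch f J y)" "(x, y) \<in> value_graph n" "J \<in> D" "y \<in> J"
      by (auto simp: value_graph_def V_Suc)
    then show "z \<in> (\<Union>J\<in>D. (\<lambda>p. (fst p, branch f J (snd p))) ` (value_graph n \<inter> UNIV \<times> J))"
      by (intro UN_I[of J] image_eqI[of _ _ "(x, y)"]) auto
  next
    fix z assume "z \<in> (\<Union>J\<in>D. (\<lambda>p. (fst p, branch f J (snd p))) ` (value_graph n \<inter> UNIV \<times> J))"
    then show "z \<in> value_graph (Suc n)"
      by (fastforce simp: value_graph_def V_Suc)
  qed
  show ?case
    unfolding eq
  proof (intro compact_UN finite_D compact_continuous_image)
    fix J assume J: "J \<in> D"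
    then have "closed J" using lap_interval[OF J] closed_atLeastAtMost by metis
    then show "compact (value_graph n \<inter> UNIV \<times> J)"
      using Suc by (intro compact_Int_closed closed_Times) auto
    show "continuous_on (value_graph n \<inter> UNIV \<times> J) (\<lambda>p. (fst p, branch f J (snd p)))"
      by (intro continuous_intros continuous_on_compose2[OF branch_continuous[OF J]]) auto
  qed
qed

lemma value_graph_limit:
  assumes "G \<noteq> bot" "(p \<longlongrightarrow> x) G" "(q \<longlongrightarrow> y) G"
    and "\<forall>\<^sub>F i in G. p i \<in> {a..b} \<and> q i \<in> V n (p i)"
  shows "y \<in> V n x"
proof -
  have "((\<lambda>i. (p i, q i)) \<longlongrightarrow> (x, y)) G"
    using assms by (intro tendsto_intros)
  moreover have "\<forall>\<^sub>F i in G. (p i, q i) \<in> value_graph n"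
    using assms(4) by (simp add: value_graph_def)
  ultimately have "(x, y) \<in> value_graph n"
    using assms(1) by (intro Lim_in_closed_set[OF compact_imp_closed[OF compact_value_graph]])
  then show ?thesis by (simp add: value_graph_def)
qed


subsection \<open>Monotone continuous selections and maximal intervals\<close>

abbreviation P :: "nat \<Rightarrow> real set \<Rightarrow> bool" where
  "P n \<equiv> iterate_continuous_monotone f D n"

text \<open>The witness in \<open>iterate_continuous_monotone\<close> with its direction made
  explicit: gluing and passing to limits both need matching directions.\<close>

definition selection :: "(real \<Rightarrow> real \<Rightarrow> bool) \<Rightarrow> nat \<Rightarrow> real set \<Rightarrow> (real \<Rightarrow> real) \<Rightarrow> bool" where
  "selection R n K F \<longleftrightarrow> continuous_on K F \<and> monotone_on K (\<le>) R F \<and> (\<forall>x\<in>K. F x \<in> V n x)"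

lemma P_iff: "P n K \<longleftrightarrow> (\<exists>R F. directed R \<and> selection R n K F)"
  unfolding iterate_continuous_monotone_def monotonic_on_iff selection_def by blast

lemma selection_subset: "selection R n K F \<Longrightarrow> K' \<subseteq> K \<Longrightarrow> selection R n K' F"
  unfolding selection_def by (meson continuous_on_subset monotone_on_subset subsetD)

lemma P_subset: "P n K \<Longrightarrow> K' \<subseteq> K \<Longrightarrow> P n K'"
  unfolding P_iff using selection_subset by blast

lemma P_subinterval: "P n {p..q} \<Longrightarrow> p \<le> p' \<Longrightarrow> p' \<le> q' \<Longrightarrow> q' \<le> q \<Longrightarrow> P n {p'..q'}"
  by (erule P_subset) auto

lemma P_constant:
  assumes "\<And>x. x \<in> K \<Longrightarrow> y \<in> V n x"
  shows "P n K"
  unfolding P_iff selection_def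
  by (intro exI[of _ "(\<le>)"] exI[of _ "\<lambda>_. y"]) (auto simp: assms monotone_on_def)

lemma P_singleton:
  assumes "x \<in> {a..b}"
  shows "P n {x}"
  using V_nonempty[OF assms, of n] by (auto intro: P_constant)

lemma selection_glue:
  assumes R: "directed R" and F: "selection R n {u..r} F" and G: "selection R n {r..v} G"
    and "F r = G r" "u \<le> r" "r \<le> v"
  shows "selection R n {u..v} (\<lambda>x. if x \<le> r then F x else G x)"
  unfolding selection_def
proof (intro conjI ballI)
  have "{t \<in> {u..v}. t \<le> r} = {u..r}" "{t \<in> {u..v}. r \<le> t} = {r..v}"
    using assms by auto
  then show "continuous_on {u..v} (\<lambda>x. if x \<le> r then F x else G x)"
    using F G assms(4) unfolding selection_def by (intro continuous_on_cases_le) auto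
  show "(if x \<le> r then F x else G x) \<in> V n x" if "x \<in> {u..v}" for x
    using F G that unfolding selection_def by auto
  have FR: "R (F x) (F y)" if "u \<le> x" "x \<le> y" "y \<le> r" for x y
    using F that unfolding selection_def monotone_on_def by auto
  have GR: "R (G x) (G y)" if "r \<le> x" "x \<le> y" "y \<le> v" for x y
    using G that unfolding selection_def monotone_on_def by auto
  show "monotone_on {u..v} (\<le>) R (\<lambda>x. if x \<le> r then F x else G x)"
  proof (rule monotone_onI)
    fix x y assume xy: "x \<in> {u..v}" "y \<in> {u..v}" "x \<le> y"
    show "R (if x \<le> r then F x else G x) (if y \<le> r then F y else G y)"
    proof (cases "x \<le> r \<and> r < y")
      case True
      then have "R (F x) (F r)" "R (G r) (G y)"
        using FR[of x r] GR[of r y] xy by auto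
      then have "R (F x) (G y)"
        using assms(4) directed_order(2)[OF R] by metis
      then show ?thesis using True by simp
    next
      case False
      then show ?thesis using FR[of x y] GR[of x y] xy by auto
    qed
  qed
qed

lemma not_value_nearby:
  assumes "x \<in> {a..b}" "c \<notin> V n x"
  obtains d where "d > 0" "\<And>\<xi>. \<xi> \<in> {a..b} \<Longrightarrow> dist \<xi> x < d \<Longrightarrow> c \<notin> V n \<xi>"
proof -
  have "closed ((\<lambda>\<xi>. (\<xi>, c)) -` value_graph n)"
    by (intro closed_vimage compact_imp_closed[OF compact_value_graph] continuous_intros)
  then have "open (- ((\<lambda>\<xi>. (\<xi>, c)) -` value_graph n))" by (rule open_Compl)
  moreover have "x \<in> - ((\<lambda>\<xi>. (\<xi>, c)) -` value_graph n)"
    using assms by (simp add: value_graph_def)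
  ultimately obtain d where d: "d > 0" "\<And>\<xi>. dist \<xi> x < d \<Longrightarrow> \<xi> \<in> - ((\<lambda>\<xi>. (\<xi>, c)) -` value_graph n)"
    unfolding open_dist by blast
  have "c \<notin> V n \<xi>" if "\<xi> \<in> {a..b}" "dist \<xi> x < d" for \<xi>
    using d(2)[OF that(2)] that(1) by (simp add: value_graph_def)
  with d(1) that show ?thesis by blast
qed

text \<open>A jump of \<open>F\<close> at \<open>x\<close> would, the graph of the values being closed, force all the points of an
  interval into the finite set of values at \<open>x\<close>.\<close>

lemma continuous_if_intermediate_values:
  assumes sub: "{u..v} \<subseteq> {a..b}"
    and iv: "\<And>s t c. u \<le> s \<Longrightarrow> s < t \<Longrightarrow> t \<le> v \<Longrightarrow> min (F s) (F t) < c \<Longrightarrow> c < max (F s) (F t) \<Longrightarrow>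
      \<exists>\<xi>\<in>{s..t}. c \<in> V n \<xi>"
  shows "continuous_on {u..v} F"
proof (rule ccontr)
  assume "\<not> continuous_on {u..v} F"
  then obtain x e where x: "x \<in> {u..v}" and e: "e > 0"
    and "\<forall>d>0. \<exists>y\<in>{u..v}. dist y x < d \<and> \<not> dist (F y) (F x) < e"
    unfolding continuous_on_iff by blast
  then have jump: "\<exists>y\<in>{u..v}. dist y x < d \<and> e \<le> dist (F y) (F x)" if "d > 0" for d
    using that by (simp add: not_less)
  \<comment> \<open>There are only finitely many values at \<open>x\<close>, so within
    \<open>e\<close> of \<open>F x\<close>, above and below, some level is not a value at
    \<open>x\<close> and therefore not a value near \<open>x\<close> either.\<close>
  have free: "\<exists>c\<in>{p<..<q}. c \<notin> V n x" if "p < q" for p q :: real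
    using V_finite[of n x] infinite_Ioo[OF that] by (meson finite_subset subsetI)
  obtain c1 where c1: "c1 \<in> {F x<..<F x + e}" "c1 \<notin> V n x" using free e by (meson less_add_same_cancel1)
  obtain c2 where c2: "c2 \<in> {F x - e<..<F x}" "c2 \<notin> V n x" using free[of "F x - e" "F x"] e by auto
  have xab: "x \<in> {a..b}" using x sub by auto
  obtain d1 where d1: "d1 > 0" "\<And>\<xi>. \<xi> \<in> {a..b} \<Longrightarrow> dist \<xi> x < d1 \<Longrightarrow> c1 \<notin> V n \<xi>"
    using not_value_nearby[OF xab c1(2)] by metis
  obtain d2 where d2: "d2 > 0" "\<And>\<xi>. \<xi> \<in> {a..b} \<Longrightarrow> dist \<xi> x < d2 \<Longrightarrow> c2 \<notin> V n \<xi>"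
    using not_value_nearby[OF xab c2(2)] by metis
  obtain y where y: "y \<in> {u..v}" "dist y x < min d1 d2" "e \<le> dist (F y) (F x)"
    using jump[of "min d1 d2"] d1 d2 by auto
  have xy: "x \<noteq> y" using y e by auto
  obtain c where c: "c = c1 \<or> c = c2" "min (F x) (F y) < c" "c < max (F x) (F y)"
    using y(3) c1(1) c2(1) by (cases "F x \<le> F y") (auto simp: dist_real_def)
  have "\<exists>\<xi>\<in>{min x y..max x y}. c \<in> V n \<xi>"
  proof (cases "x < y")
    case True
    then show ?thesis using iv[of x y c] c(2,3) x y(1) by simp
  next
    case False
    then show ?thesis
      using iv[of y x c] c(2,3) x y(1) xy by (simp add: min.commute[of "F y"] max.commute[of "F y"])
  qed
  then obtain \<xi> where "\<xi> \<in> {min x y..max x y}" "c \<in> V n \<xi>" by blast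
  moreover from this have "\<xi> \<in> {a..b}" "dist \<xi> x < min d1 d2"
    using x y(1,2) sub by (auto simp: dist_real_def)
  ultimately show False using d1(2) d2(2) c(1) by auto
qed

lemma selection_limit:
  assumes R: "directed R" and uv: "u < v" "{u..v} \<subseteq> {a..b}"
    and lim: "\<And>e. e > 0 \<Longrightarrow> \<exists>p q F. u \<le> p \<and> p < u + e \<and> v - e < q \<and> q \<le> v \<and> p \<le> q \<and> selection R n {p..q} F"
  shows "\<exists>F. selection R n {u..v} F"
proof -
  have "\<forall>k. \<exists>p q F. u \<le> p \<and> p < u + 1 / real (Suc k) \<and> v - 1 / real (Suc k) < q \<and> q \<le> v \<and> p \<le> q \<and>
      selection R n {p..q} F"
    using lim by simp
  then obtain p q F where p: "\<And>k. u \<le> p k" "\<And>k. p k < u + 1 / real (Suc k)"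
    and q: "\<And>k. v - 1 / real (Suc k) < q k" "\<And>k. q k \<le> v" and pq: "\<And>k. p k \<le> q k"
    and F: "\<And>k. selection R n {p k..q k} (F k)"
    by metis
  have inv: "(\<lambda>k. 1 / real (Suc k)) \<longlonglongrightarrow> 0"
    using LIMSEQ_inverse_real_of_nat by (simp add: inverse_eq_divide)
  have "(\<lambda>k. u + 1 / real (Suc k)) \<longlonglongrightarrow> u" using tendsto_add[OF tendsto_const inv, of u] by simp
  with tendsto_const have plim: "p \<longlonglongrightarrow> u"
    by (rule tendsto_sandwich[rotated 2]) (use p in \<open>auto intro!: always_eventually less_imp_le simp del: of_nat_Suc\<close>)
  have "(\<lambda>k. v - 1 / real (Suc k)) \<longlonglongrightarrow> v" using tendsto_diff[OF tendsto_const inv, of v] by simp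
  from this tendsto_const have qlim: "q \<longlonglongrightarrow> v"
    by (rule tendsto_sandwich[rotated 2]) (use q in \<open>auto intro!: always_eventually less_imp_le simp del: of_nat_Suc\<close>)
  \<comment> \<open>Clamping into \<open>{p k..q k}\<close> makes all approximants usable at every
    point, so that a pointwise limit can be formed.\<close>
  define C where "C k x = max (p k) (min (q k) x)" for k x
  have C: "C k x \<in> {p k..q k}" for k x using pq[of k] by (auto simp: C_def)
  have Cab: "C k x \<in> {a..b}" for k x
    using C[of k x] p(1)[of k] q(2)[of k] uv by auto
  have FV: "F k (C k x) \<in> V n (C k x)" for k x
    using F[of k] C by (auto simp: selection_def)
  have "F k (C k x) \<in> {a..b}" for k x
    using V_range[OF Cab] FV by blast
  then obtain G \<phi> where G: "G \<noteq> bot" "G \<le> sequentially" "\<And>x. ((\<lambda>k. F k (C k x)) \<longlongrightarrow> \<phi> x) G"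
    using convergent_refinement[of sequentially "\<lambda>k x. F k (C k x)" a b] sequentially_bot by blast
  have pG: "(p \<longlongrightarrow> u) G" and qG: "(q \<longlongrightarrow> v) G"
    using plim qlim G(2) by (auto intro: tendsto_mono)
  have "\<phi> x \<in> V n x" if "x \<in> {u..v}" for x
  proof (rule value_graph_limit[OF G(1) _ G(3)])
    have "((\<lambda>k. C k x) \<longlongrightarrow> max u (min v x)) G"
      unfolding C_def by (intro tendsto_intros pG qG)
    then show "((\<lambda>k. C k x) \<longlongrightarrow> x) G" using that by simp
  qed (use Cab FV in simp)
  moreover have "monotone_on {u..v} (\<le>) R \<phi>"
  proof (rule monotone_onI)
    fix x y :: real assume "x \<le> y"
    then have "C k x \<le> C k y" for k by (auto simp: C_def)
    then have "R (F k (C k x)) (F k (C k y))" for k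
      using F[of k] C[of k] by (auto simp: selection_def monotone_on_def)
    then show "R (\<phi> x) (\<phi> y)"
      using R tendsto_le[OF G(1) G(3) G(3)] by auto
  qed
  moreover have "continuous_on {u..v} \<phi>"
  proof (rule continuous_if_intermediate_values[OF uv(2)])
    fix s t c assume st: "u \<le> s" "s < t" "t \<le> v" and c: "min (\<phi> s) (\<phi> t) < c" "c < max (\<phi> s) (\<phi> t)"
    have "((\<lambda>k. min (F k (C k s)) (F k (C k t))) \<longlongrightarrow> min (\<phi> s) (\<phi> t)) G"
      "((\<lambda>k. max (F k (C k s)) (F k (C k t))) \<longlongrightarrow> max (\<phi> s) (\<phi> t)) G"
      by (intro tendsto_intros G(3))+
    then have "\<forall>\<^sub>F k in G. min (F k (C k s)) (F k (C k t)) < c" "\<forall>\<^sub>F k in G. c < max (F k (C k s)) (F k (C k t))"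
      using c by (auto intro: order_tendstoD)
    moreover have "\<forall>\<^sub>F k in G. p k < t" "\<forall>\<^sub>F k in G. s < q k"
      using order_tendstoD[OF pG] order_tendstoD[OF qG] st by auto
    ultimately have "\<forall>\<^sub>F k in G. min (F k (C k s)) (F k (C k t)) < c \<and> c < max (F k (C k s)) (F k (C k t)) \<and>
        p k < t \<and> s < q k"
      by (simp add: eventually_conj)
    then obtain k where k: "min (F k (C k s)) (F k (C k t)) < c" "c < max (F k (C k s)) (F k (C k t))"
        "p k < t" "s < q k"
      using eventually_happens G(1) by blast
    have Ck: "continuous_on {s..t} (C k)"
      unfolding C_def by (intro continuous_intros)
    have Fk: "continuous_on {p k..q k} (F k)"
      using F[of k] unfolding selection_def by blast
    have cont: "continuous_on {s..t} (\<lambda>x. F k (C k x))"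
      by (rule continuous_on_compose2[OF Fk Ck]) (use C in blast)
    have "\<exists>x. s \<le> x \<and> x \<le> t \<and> F k (C k x) = c"
    proof (cases "F k (C k s) \<le> F k (C k t)")
      case True
      then show ?thesis using k st cont by (intro IVT'[where f = "\<lambda>x. F k (C k x)"]) (auto simp: min_def max_def)
    next
      case False
      then show ?thesis using k st cont by (intro IVT2'[where f = "\<lambda>x. F k (C k x)"]) (auto simp: min_def max_def)
    qed
    then obtain x where "s \<le> x" "x \<le> t" "F k (C k x) = c" by blast
    \<comment> \<open>The conditions \<open>p k < t\<close> and \<open>s < q k\<close> ensure that
      clamping does not push points of \<open>{s..t}\<close> out of it.\<close>
    moreover from this have "C k x \<in> {s..t}"
      using k st pq[of k] by (auto simp: C_def)
    ultimately show "\<exists>\<xi>\<in>{s..t}. c \<in> V n \<xi>" using FV[of k x] by auto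
  qed
  ultimately show ?thesis unfolding selection_def by blast
qed

text \<open>The direction may vary with \<open>e\<close>. One of the two serves every
  \<open>e\<close>, because an approximation that is good enough for \<open>e\<close> is good enough
  for every larger bound.\<close>

lemma P_limit:
  assumes uv: "u < v" "{u..v} \<subseteq> {a..b}"
    and lim: "\<And>e. e > 0 \<Longrightarrow> \<exists>p q. u \<le> p \<and> p < u + e \<and> v - e < q \<and> q \<le> v \<and> p \<le> q \<and> P n {p..q}"
  shows "P n {u..v}"
proof -
  define A where "A R e \<longleftrightarrow> (\<exists>p q F. u \<le> p \<and> p < u + e \<and> v - e < q \<and> q \<le> v \<and> p \<le> q \<and> selection R n {p..q} F)"
    for R e
  have A_mono: "A R e'" if "A R e" "e \<le> e'" for R e e'
    using that unfolding A_def by (smt (verit))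
  have A: "A (\<le>) e \<or> A (\<ge>) e" if "e > 0" for e
    using lim[OF that] unfolding P_iff A_def by blast
  have "\<exists>R. directed R \<and> (\<forall>e>0. A R e)"
  proof (cases "\<forall>e>0. A (\<le>) e")
    case False
    then obtain e0 where e0: "e0 > 0" "\<not> A (\<le>) e0" by blast
    have "A (\<ge>) e" if "e > 0" for e
      using A[of "min e e0"] A_mono[of _ "min e e0"] that e0 by (metis min.cobounded1 min.cobounded2 min_less_iff_conj)
    then show ?thesis by blast
  qed blast
  then obtain R where "directed R" "\<And>e. e > 0 \<Longrightarrow> A R e" by blast
  then show ?thesis
    using selection_limit[OF _ uv, of R n] unfolding P_iff A_def by blast
qed

section \<open>Maximal intervals and lap numbers\<close>

abbreviation maximal :: "nat \<Rightarrow> real set set" where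
  "maximal n \<equiv> maximal_intervals a b (P n)"

lemma maximalI:
  assumes "a \<le> u" "u < v" "v \<le> b" "P n {u..v}"
    and max: "\<And>s t. a \<le> s \<Longrightarrow> s \<le> u \<Longrightarrow> v \<le> t \<Longrightarrow> t \<le> b \<Longrightarrow> P n {s..t} \<Longrightarrow> s = u \<and> t = v"
  shows "{u..v} \<in> maximal n"
proof -
  define S where "S = {{u..v} | u v. a \<le> u \<and> u < v \<and> v \<le> b \<and> P n {u..v}}"
  have eq: "maximal n = {J \<in> S. \<forall>K\<in>S. J \<subseteq> K \<longrightarrow> K = J}"
    by (simp only: S_def maximal_intervals_def Let_def)
  have "K = {u..v}" if K: "K \<in> S" "{u..v} \<subseteq> K" for K
  proof -
    obtain s t where st: "K = {s..t}" "a \<le> s" "s < t" "t \<le> b" "P n {s..t}"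
      using K(1) unfolding S_def by blast
    moreover have "s \<le> u" "v \<le> t" using K(2) st assms(2) by simp_all
    ultimately show ?thesis using max[of s t] by simp
  qed
  moreover have "{u..v} \<in> S"
    unfolding S_def by (intro CollectI exI[of _ u] exI[of _ v] conjI refl assms(1-4))
  ultimately show ?thesis
    unfolding eq by simp
qed

lemma maximalE:
  assumes "K \<in> maximal n"
  obtains u v where "K = {u..v}" "a \<le> u" "u < v" "v \<le> b" "P n {u..v}"
    "\<And>s t. a \<le> s \<Longrightarrow> s \<le> u \<Longrightarrow> v \<le> t \<Longrightarrow> t \<le> b \<Longrightarrow> P n {s..t} \<Longrightarrow> s = u \<and> t = v"
proof -
  define S where "S = {{u..v} | u v. a \<le> u \<and> u < v \<and> v \<le> b \<and> P n {u..v}}"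
  have eq: "maximal n = {J \<in> S. \<forall>K\<in>S. J \<subseteq> K \<longrightarrow> K = J}"
    by (simp only: S_def maximal_intervals_def Let_def)
  have K: "K \<in> S" "\<forall>K'\<in>S. K \<subseteq> K' \<longrightarrow> K' = K"
    using assms unfolding eq by simp_all
  from K(1) obtain u v where uv: "K = {u..v}" "a \<le> u" "u < v" "v \<le> b" "P n {u..v}"
    unfolding S_def by blast
  have "s = u \<and> t = v" if st: "a \<le> s" "s \<le> u" "v \<le> t" "t \<le> b" "P n {s..t}" for s t
  proof -
    have "{s..t} \<in> S"
      unfolding S_def by (intro CollectI exI[of _ s] exI[of _ t] conjI refl st) (use st uv in linarith)
    moreover have "K \<subseteq> {s..t}" using st uv(1) by simp
    ultimately have "{s..t} = {u..v}" using K(2) uv(1) by blast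
    then show ?thesis using uv(3) by (simp add: Icc_eq_Icc)
  qed
  with uv show ?thesis by (rule that)
qed

text \<open>The interval is extended to the right as far as possible and then to the left;
  \<open>P_limit\<close> shows that both extrema are attained. Moving the left end does not reopen
  the right one, since a larger interval restricts to one that starts at \<open>p\<close>.\<close>

lemma extends_to_maximal:
  assumes pq: "a \<le> p" "p < q" "q \<le> b" "P n {p..q}"
  obtains K where "K \<in> maximal n" "{p..q} \<subseteq> K"
proof -
  define A where "A = {v. q \<le> v \<and> v \<le> b \<and> P n {p..v}}"
  define v where "v = Sup A"
  have A: "q \<in> A" "bdd_above A" using pq by (auto simp: A_def)
  have v: "q \<le> v" "v \<le> b"
    unfolding v_def using A by (auto intro: cSup_upper) (auto intro!: cSup_least simp: A_def)
  have "P n {p..v}"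
  proof (rule P_limit)
    fix e :: real assume "e > 0"
    then obtain v' where "v' \<in> A" "v - e < v'"
      using less_cSupD[of A "v - e"] A unfolding v_def by auto
    moreover from this have "v' \<le> v" unfolding v_def using A by (auto intro: cSup_upper)
    ultimately show "\<exists>s t. p \<le> s \<and> s < p + e \<and> v - e < t \<and> t \<le> v \<and> s \<le> t \<and> P n {s..t}"
      using \<open>e > 0\<close> pq by (intro exI[of _ p] exI[of _ v']) (auto simp: A_def)
  qed (use pq v in auto)
  define B where "B = {u. a \<le> u \<and> u \<le> p \<and> P n {u..v}}"
  define u where "u = Inf B"
  have B: "p \<in> B" "bdd_below B" using pq \<open>P n {p..v}\<close> by (auto simp: B_def)
  have u: "u \<le> p" "a \<le> u"
    unfolding u_def using B by (auto intro: cInf_lower) (auto intro!: cInf_greatest simp: B_def)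
  have "P n {u..v}"
  proof (rule P_limit)
    fix e :: real assume "e > 0"
    then obtain u' where "u' \<in> B" "u' < u + e"
      using cInf_lessD[of B "u + e"] B unfolding u_def by auto
    moreover from this have "u \<le> u'" unfolding u_def using B by (auto intro: cInf_lower)
    ultimately show "\<exists>s t. u \<le> s \<and> s < u + e \<and> v - e < t \<and> t \<le> v \<and> s \<le> t \<and> P n {s..t}"
      using \<open>e > 0\<close> pq v by (intro exI[of _ u'] exI[of _ v]) (auto simp: B_def)
  qed (use pq v u in auto)
  moreover have "s = u \<and> t = v" if st: "a \<le> s" "s \<le> u" "v \<le> t" "t \<le> b" "P n {s..t}" for s t
  proof -
    have "P n {p..t}" by (rule P_subinterval[OF st(5)]) (use u v st pq in linarith)+
    then have "t \<in> A" using st v by (auto simp: A_def)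
    then have "t \<le> v" unfolding v_def using A by (auto intro: cSup_upper)
    then have "t = v" using st by simp
    then have "s \<in> B" using st u by (auto simp: B_def)
    then have "u \<le> s" unfolding u_def using B by (auto intro: cInf_lower)
    then show ?thesis using st \<open>t = v\<close> by simp
  qed
  ultimately have "{u..v} \<in> maximal n"
    by (intro maximalI) (use u v pq in auto)
  then show ?thesis
    by (rule that) (use u v in auto)
qed

text \<open>Two maximal intervals through \<open>r\<close> with the same direction and the same value at \<open>r\<close> could be
  glued at \<open>r\<close> to a larger one.\<close>

lemma maximal_through_point:
  shows "finite {K \<in> maximal n. r \<in> K}" "card {K \<in> maximal n. r \<in> K} \<le> 2 * card (V n r)"
proof -
  have "P n K" if "K \<in> maximal n" for K
    using maximalE[OF that] by metis
  then have "\<forall>K\<in>maximal n. \<exists>R F. directed R \<and> selection R n K F"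
    unfolding P_iff by blast
  then obtain R F where RF: "\<And>K. K \<in> maximal n \<Longrightarrow> directed (R K) \<and> selection (R K) n K (F K)"
    by metis
  let ?i = "\<lambda>K. (R K, F K r)"
  let ?T = "{(\<le>), (\<ge>) :: real \<Rightarrow> real \<Rightarrow> bool} \<times> V n r"
  have sub: "?i ` {K \<in> maximal n. r \<in> K} \<subseteq> ?T"
    using RF by (auto simp: selection_def)
  have less: "False" if K: "K \<in> maximal n" "r \<in> K" and K': "K' \<in> maximal n" "r \<in> K'"
    and eq: "?i K = ?i K'" and ne: "K \<noteq> K'" and le: "Inf K \<le> Inf K'" for K K'
  proof -
    obtain u v where uv: "K = {u..v}" "a \<le> u" "u < v" "v \<le> b" "P n {u..v}"
      and max: "\<And>s t. a \<le> s \<Longrightarrow> s \<le> u \<Longrightarrow> v \<le> t \<Longrightarrow> t \<le> b \<Longrightarrow> P n {s..t} \<Longrightarrow> s = u \<and> t = v"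
      using maximalE[OF K(1)] by metis
    obtain u' v' where uv': "K' = {u'..v'}" "a \<le> u'" "u' < v'" "v' \<le> b" "P n {u'..v'}"
      and max': "\<And>s t. a \<le> s \<Longrightarrow> s \<le> u' \<Longrightarrow> v' \<le> t \<Longrightarrow> t \<le> b \<Longrightarrow> P n {s..t} \<Longrightarrow> s = u' \<and> t = v'"
      using maximalE[OF K'(1)] by metis
    have "u \<le> u'" using le uv uv' by simp
    have "v < v'"
    proof (rule ccontr)
      assume "\<not> v < v'"
      then have "u = u' \<and> v = v'"
        using max'[of u v] \<open>u \<le> u'\<close> uv by simp
      then show False using ne uv uv' by simp
    qed
    have dir: "directed (R K)" "R K' = R K" "F K r = F K' r"
      using RF[OF K(1)] eq by simp_all
    have r: "u \<le> r" "r \<le> v" "u' \<le> r" "r \<le> v'"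
      using K(2) K'(2) uv(1) uv'(1) by simp_all
    have s1: "selection (R K) n {u..r} (F K)"
      by (rule selection_subset[of _ _ K]) (use RF[OF K(1)] uv(1) r in auto)
    have s2: "selection (R K) n {r..v'} (F K')"
      by (rule selection_subset[of _ _ K']) (use RF[OF K'(1)] uv'(1) r dir(2) in auto)
    have "selection (R K) n {u..v'} (\<lambda>x. if x \<le> r then F K x else F K' x)"
      by (rule selection_glue[where r = r and F = "F K" and G = "F K'", OF dir(1) s1 s2 dir(3) r(1,4)])
    then have "P n {u..v'}" unfolding P_iff using dir(1) by blast
    then show False using max[of u v'] uv uv' \<open>v < v'\<close> by simp
  qed
  have "inj_on ?i {K \<in> maximal n. r \<in> K}"
  proof (rule inj_onI, rule ccontr)
    fix K K' assume KK': "K \<in> {K \<in> maximal n. r \<in> K}" "K' \<in> {K \<in> maximal n. r \<in> K}"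
      "?i K = ?i K'" "K \<noteq> K'"
    consider "Inf K \<le> Inf K'" | "Inf K' \<le> Inf K" by linarith
    then show False
    proof cases
      case 1
      show False by (rule less[of K K']) (use KK' 1 in simp_all)
    next
      case 2
      show False by (rule less[of K' K]) (use KK' 2 in simp_all)
    qed
  qed
  moreover have T: "finite ?T" by (simp add: V_finite)
  ultimately show "finite {K \<in> maximal n. r \<in> K}"
    using sub inj_on_finite by blast
  have "card {K \<in> maximal n. r \<in> K} \<le> card ?T"
    using card_inj_on_le[OF \<open>inj_on _ _\<close> sub T] .
  also have "card ?T \<le> 2 * card (V n r)"
    by (simp add: card_cartesian_product card_insert_if)
  finally show "card {K \<in> maximal n. r \<in> K} \<le> 2 * card (V n r)" .
qed

text \<open>Every maximal interval contains one of the at most \<open>N + 1\<close> cut points, as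
  otherwise it would lie strictly inside a piece; through each cut point pass at most two per value.
  Conversely, every point lies in a non-degenerate piece, which extends to a maximal interval, so
  the maximal intervals cover \<open>[a, b]\<close>.\<close>

lemma
  assumes "splits (P n) N a b"
  shows lap_number_le: "lap_number a b f D n \<le> Suc N * (2 * (1 + n * card endpoint_values))"
    and splits_lap_number: "splits (P n) (lap_number a b f D n) a b"
proof -
  obtain R where R: "finite R" "card R \<le> Suc N"
    "\<And>s t. a \<le> s \<Longrightarrow> s \<le> t \<Longrightarrow> t \<le> b \<Longrightarrow> {s..t} \<inter> R = {} \<Longrightarrow>
      \<exists>p q. a \<le> p \<and> p < s \<and> t < q \<and> q \<le> b \<and> P n {p..q}"
    using splits_endpoints[OF assms] by blast
  have eq: "maximal n = (\<Union>r\<in>R. {K \<in> maximal n. r \<in> K})"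
  proof (intro equalityI subsetI)
    fix K assume K: "K \<in> maximal n"
    then obtain u v where uv: "K = {u..v}" "a \<le> u" "u < v" "v \<le> b"
      and max: "\<And>s t. a \<le> s \<Longrightarrow> s \<le> u \<Longrightarrow> v \<le> t \<Longrightarrow> t \<le> b \<Longrightarrow> P n {s..t} \<Longrightarrow> s = u \<and> t = v"
      using maximalE[OF K] by metis
    have "{u..v} \<inter> R \<noteq> {}"
    proof
      assume "{u..v} \<inter> R = {}"
      then obtain p q where "a \<le> p" "p < u" "v < q" "q \<le> b" "P n {p..q}"
        using R(3)[of u v] uv by auto
      then show False using max[of p q] by simp
    qed
    then show "K \<in> (\<Union>r\<in>R. {K \<in> maximal n. r \<in> K})" using uv K by auto
  qed auto
  have fin: "finite (maximal n)"
    by (subst eq) (simp add: R(1) maximal_through_point)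
  have "card (maximal n) \<le> (\<Sum>r\<in>R. card {K \<in> maximal n. r \<in> K})"
    by (subst eq) (rule card_UN_le[OF R(1)])
  also have "\<dots> \<le> (\<Sum>r\<in>R. 2 * (1 + n * card endpoint_values))"
    by (intro sum_mono order_trans[OF maximal_through_point(2)] mult_left_mono card_V_le) auto
  also have "\<dots> \<le> Suc N * (2 * (1 + n * card endpoint_values))"
    by (simp only: sum_constant of_nat_id mult_le_mono1[OF R(2)])
  finally show "lap_number a b f D n \<le> Suc N * (2 * (1 + n * card endpoint_values))"
    unfolding lap_number_def .
  have "{a..b} \<subseteq> \<Union>(maximal n)"
  proof
    fix x assume "x \<in> {a..b}"
    then obtain p q where "a \<le> p" "p < q" "q \<le> b" "x \<in> {p..q}" "P n {p..q}"
      using splits_nondegenerate_piece[OF assms ab] by metis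
    then show "x \<in> \<Union>(maximal n)"
      using extends_to_maximal[of p q n] by blast
  qed
  moreover have "P n K \<and> (\<exists>p q. p \<le> q \<and> K = {p..q})" if "K \<in> maximal n" for K
    using maximalE[OF that] by (metis less_imp_le)
  ultimately have "\<exists>M\<le>card (maximal n). splits (P n) M a b"
    by (intro splits_of_cover[OF fin] less_imp_le[OF ab]) (blast intro: P_subinterval)+
  then obtain M where M: "M \<le> card (maximal n)" "splits (P n) M a b" by blast
  then show "splits (P n) (lap_number a b f D n) a b"
    unfolding lap_number_def by (intro splits_mono[OF M(2,1)] P_singleton) (use ab in simp)
qed

end

subsection \<open>Counting pieces and the growth rate\<close>

text \<open>In contrast to \<open>splits_cut\<close>, throwing away what lies outside never
  increases the number of pieces, so no 1 is lost.\<close>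

lemma splits_subinterval:
  assumes sub: "\<And>p q p' q'. P {p..q} \<Longrightarrow> p \<le> p' \<Longrightarrow> p' \<le> q' \<Longrightarrow> q' \<le> q \<Longrightarrow> P {p'..q'}"
    and N: "splits P N u w" and pq: "u \<le> p" "p \<le> q" "q \<le> w"
  shows "\<exists>N'\<le>N. splits P N' p q"
proof -
  have left: "\<exists>N'\<le>N. splits P N' p w" if "splits P N u w" "u \<le> p" "p \<le> w" for u N
    using that
  proof (induction N arbitrary: u)
    case (Suc N)
    then obtain z where z: "u \<le> z" "z \<le> w" "P {u..z}" "splits P N z w" by auto
    show ?case
    proof (cases "p \<le> z")
      case True
      then have "splits P (Suc N) p w" using z sub[OF z(3) Suc.prems(2) True] by auto
      then show ?thesis by blast
    next
      case False
      then show ?thesis using Suc.IH[OF z(4)] Suc.prems by (meson le_SucI linear)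
    qed
  qed auto
  have right: "\<exists>N'\<le>N. splits P N' p q" if "splits P N p w" "p \<le> q" for p N
    using that
  proof (induction N arbitrary: p)
    case 0
    then show ?case using pq by auto
  next
    case (Suc N)
    then obtain z where z: "p \<le> z" "z \<le> w" "P {p..z}" "splits P N z w" by auto
    show ?case
    proof (cases "q \<le> z")
      case True
      then have "splits P (Suc 0) p q" using z sub[OF z(3) _ Suc.prems(2) True] Suc.prems(2) by auto
      then show ?thesis by (meson le0 Suc_le_mono)
    next
      case False
      then obtain N' where "N' \<le> N" "splits P N' z q" using Suc.IH[OF z(4)] by auto
      then have "splits P (Suc N') p q" using z False by auto
      then show ?thesis using \<open>N' \<le> N\<close> by (meson Suc_le_mono)
    qed
  qed
  obtain N1 where "N1 \<le> N" "splits P N1 p w" using left[OF N] pq by auto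
  then show ?thesis using right[of N1 p] pq by (meson order_trans)
qed

lemma at_within_Ioo_neq_bot:
  fixes x y t :: real
  assumes "x < y" "t \<in> {x..y}"
  shows "at t within {x<..<y} \<noteq> bot"
proof -
  have "t \<in> closure {x<..<y}" using assms by simp
  then have "t islimpt {x<..<y}"
    using interior_limit_point[of t "{x<..<y}"] by (auto simp: closure_def)
  then show ?thesis by (simp add: trivial_limit_within)
qed

section \<open>Composition of selections and preimages of pieces\<close>

context piecewise_monotone begin

lemma P_compose:
  assumes R: "directed R" and F: "selection R k K F" and n: "P n K'" and sub: "F ` K \<subseteq> K'"
  shows "P (k + n) K"
proof -
  obtain S G where S: "directed S" and G: "selection S n K' G" using n unfolding P_iff by blast
  \<comment> \<open>\<open>T\<close> is defined by testing whether \<open>R\<close> is the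
    increasing direction, so the two relations must be known to differ.\<close>
  have ne: "(\<lambda>x y::real. y \<le> x) \<noteq> (\<le>)"
  proof
    assume "(\<lambda>x y::real. y \<le> x) = (\<le>)"
    from fun_cong[OF fun_cong[OF this, of 0], of 1] show False by simp
  qed
  define T where "T = (if R = (\<le>) then S else (\<lambda>x y. S y x))"
  have "directed T" using S by (auto simp: T_def)
  moreover have "selection T (k + n) K (\<lambda>x. G (F x))"
    unfolding selection_def
  proof (intro conjI ballI)
    show "continuous_on K (\<lambda>x. G (F x))"
      using F G sub by (auto simp: selection_def intro: continuous_on_compose2)
    show "G (F x) \<in> V (k + n) x" if "x \<in> K" for x
      using F G sub that by (auto simp: selection_def V_add)
    show "monotone_on K (\<le>) T (\<lambda>x. G (F x))"
    proof (rule monotone_onI)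
      fix x y assume xy: "x \<in> K" "y \<in> K" "x \<le> y"
      then have "R (F x) (F y)" using F by (auto simp: selection_def monotone_on_def)
      moreover have "F x \<in> K'" "F y \<in> K'" using xy sub by auto
      moreover have "monotone_on K' (\<le>) S G" using G by (simp add: selection_def)
      ultimately show "T (G (F x)) (G (F y))"
        using R ne by (auto simp: T_def monotone_on_def)
    qed
  qed
  ultimately show ?thesis unfolding P_iff by blast
qed

lemma selection_in: "selection R n K F \<Longrightarrow> K \<subseteq> {a..b} \<Longrightarrow> x \<in> K \<Longrightarrow> F x \<in> {a..b}"
  using V_range unfolding selection_def by blast

text \<open>The additional piece is needed when \<open>F\<close> is constant: then \<open>N\<close> may be \<open>0\<close>.\<close>

lemma splits_preimage_mono:
  assumes F: "selection (\<le>) k {u..v} F" and uv: "u \<le> v" "{u..v} \<subseteq> {a..b}"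
    and N: "splits (P n) N (F u) (F v)"
  shows "splits (P (k + n)) (Suc N) u v"
  using assms
proof (induction N arbitrary: u)
  case 0
  then have mono: "F x \<le> F y" if "u \<le> x" "x \<le> y" "y \<le> v" for x y
    using that by (auto simp: selection_def monotone_on_def)
  have "F ` {u..v} \<subseteq> {F u}"
    using mono[of u] mono[of _ v] 0 by (force intro: antisym)
  moreover have "P n {F u}" using selection_in[OF 0(1)] 0 by (auto intro!: P_singleton)
  ultimately show ?case
    unfolding splits_one using P_compose[OF _ 0(1)] 0 by auto
next
  case (Suc N)
  then obtain z' where z': "F u \<le> z'" "z' \<le> F v" "P n {F u..z'}" "splits (P n) N z' (F v)" by auto
  have cont: "continuous_on {u..v} F" using Suc.prems(1) by (simp add: selection_def)
  obtain z where z: "u \<le> z" "z \<le> v" "F z = z'"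
    using IVT'[of F u z' v] z' Suc.prems(2) cont by auto
  have s1: "selection (\<le>) k {u..z} F" and s2: "selection (\<le>) k {z..v} F"
    using z by (auto intro: selection_subset[OF Suc.prems(1)])
  have "F ` {u..z} \<subseteq> {F u..z'}"
    using s1 z by (auto simp: selection_def monotone_on_def)
  then have "P (k + n) {u..z}"
    using P_compose[OF _ s1 z'(3)] by blast
  moreover have "splits (P (k + n)) (Suc N) z v"
    using Suc.IH[OF s2] z z'(4) Suc.prems by (auto simp del: splits.simps)
  ultimately show ?case using z by (simp only: splits.simps(2)[of _ "Suc N"]) blast
qed

text \<open>A decreasing \<open>F\<close> reverses the order of the pieces: the leftmost piece of
  \<open>{F v..F u}\<close> pulls back to the right end of \<open>{u..v}\<close>, so this induction
  shortens the interval at \<open>v\<close>.\<close>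

lemma splits_preimage_antimono:
  assumes F: "selection (\<ge>) k {u..v} F" and uv: "u \<le> v" "{u..v} \<subseteq> {a..b}"
    and N: "splits (P n) N (F v) (F u)"
  shows "splits (P (k + n)) (Suc N) u v"
  using assms
proof (induction N arbitrary: v)
  case 0
  then have mono: "F y \<le> F x" if "u \<le> x" "x \<le> y" "y \<le> v" for x y
    using that by (auto simp: selection_def monotone_on_def)
  have "F ` {u..v} \<subseteq> {F u}"
    using mono[of u] mono[of _ v] 0 by (force intro: antisym)
  moreover have "P n {F u}" using selection_in[OF 0(1)] 0 by (auto intro!: P_singleton)
  ultimately show ?case
    unfolding splits_one using P_compose[OF _ 0(1)] 0 by auto
next
  case (Suc N)
  then obtain z' where z': "F v \<le> z'" "z' \<le> F u" "P n {F v..z'}" "splits (P n) N z' (F u)" by auto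
  have cont: "continuous_on {u..v} F" using Suc.prems(1) by (simp add: selection_def)
  obtain z where z: "u \<le> z" "z \<le> v" "F z = z'"
    using IVT2'[of F v z' u] z' Suc.prems(2) cont by auto
  have s1: "selection (\<ge>) k {u..z} F" and s2: "selection (\<ge>) k {z..v} F"
    using z by (auto intro: selection_subset[OF Suc.prems(1)])
  have "F ` {z..v} \<subseteq> {F v..z'}"
    using s2 z by (auto simp: selection_def monotone_on_def)
  then have "P (k + n) {z..v}"
    using P_compose[OF _ s2 z'(3)] by blast
  then have "splits (P (k + n)) (Suc 0) z v" using z by (simp add: splits_one)
  moreover have "splits (P (k + n)) (Suc N) u z"
    using Suc.IH[OF s1] z z'(4) Suc.prems by (auto simp del: splits.simps)
  ultimately show ?case using splits_append[of _ "Suc N" u z "Suc 0" v] by simp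
qed

lemma splits_pad:
  assumes "splits (P n) N u w" "N \<le> N'" "w \<in> {a..b}"
  shows "splits (P n) N' u w"
  using splits_mono[OF assms(1,2)] P_singleton[OF assms(3)] by blast

lemma splits_restrict:
  assumes "splits (P n) N u w" "u \<le> p" "p \<le> q" "q \<le> w" "q \<in> {a..b}"
  shows "splits (P n) N p q"
proof -
  have "\<exists>N'\<le>N. splits (P n) N' p q"
    by (rule splits_subinterval[OF _ assms(1-4)]) (rule P_subinterval)
  then show ?thesis using splits_pad assms(5) by blast
qed

text \<open>Each of the \<open>M\<close> pieces is mapped by its selection onto a subinterval of
  \<open>[a, b]\<close>, for which \<open>N\<close> pieces suffice, and pulling these back costs one
  more. This is the source of the shift by 1 in \<open>count_submultiplicative\<close>.\<close>

lemma splits_compose: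
  assumes N: "splits (P n) N a b"
  shows "splits (P k) M u v \<Longrightarrow> {u..v} \<subseteq> {a..b} \<Longrightarrow> splits (P (k + n)) (M * Suc N) u v"
proof (induction M arbitrary: u)
  case (Suc M)
  then obtain z where z: "u \<le> z" "z \<le> v" "P k {u..z}" "splits (P k) M z v" by auto
  then obtain R F where R: "directed R" and F: "selection R k {u..z} F" unfolding P_iff by blast
  have sub: "{u..z} \<subseteq> {a..b}" using z Suc.prems by auto
  have Fab: "F u \<in> {a..b}" "F z \<in> {a..b}" using selection_in[OF F sub] z by auto
  from R have "splits (P (k + n)) (Suc N) u z"
  proof
    assume R: "R = (\<le>)"
    then have "F u \<le> F z" using F z by (auto simp: selection_def monotone_on_def)
    then have "splits (P n) N (F u) (F z)" using splits_restrict[OF N] Fab by auto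
    then show ?thesis using splits_preimage_mono F z sub unfolding R by blast
  next
    assume R: "R = (\<ge>)"
    then have "F z \<le> F u" using F z by (auto simp: selection_def monotone_on_def)
    then have "splits (P n) N (F z) (F u)" using splits_restrict[OF N] Fab by auto
    then show ?thesis using splits_preimage_antimono F z sub unfolding R by blast
  qed
  moreover have "splits (P (k + n)) (M * Suc N) z v"
    using Suc.IH[OF z(4)] Suc.prems z by auto
  ultimately show ?case unfolding mult_Suc by (rule splits_append)
qed simp

lemma P_zero: "P 0 K"
  unfolding P_iff selection_def
  by (intro exI[of _ "(\<le>)"] exI[of _ "\<lambda>x. x"]) (auto simp: monotone_on_def)

lemma branch_selection:
  assumes "J \<in> D"
  obtains R where "directed R" "selection R (Suc 0) J (branch f J)" "monotone_on J (\<le>) R (branch f J)"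
proof -
  obtain R where R: "directed R" "monotone_on J (\<le>) R (branch f J)"
    using branch_monotonic[OF assms] unfolding monotonic_on_iff by blast
  then have "selection R (Suc 0) J (branch f J)"
    unfolding selection_def using branch_continuous[OF assms] assms by (auto simp: V_Suc)
  with R that show ?thesis by blast
qed

lemma P_lap: "J \<in> D \<Longrightarrow> K \<subseteq> J \<Longrightarrow> P (Suc 0) K"
  by (metis P_iff branch_selection P_subset)

lemma closed_lap: "J \<in> D \<Longrightarrow> closed J"
  by (erule lap_interval) simp

lemma lap_convex: "J \<in> D \<Longrightarrow> x \<in> J \<Longrightarrow> y \<in> J \<Longrightarrow> {x..y} \<subseteq> J"
  by (erule lap_interval) simp

text \<open>A compactness argument avoids ordering the laps along the line: close to
  \<open>x\<close> only laps that contain \<open>x\<close> occur, so on each side of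
  \<open>x\<close> a short interval lies in a single lap.\<close>

lemma splits_exists_one: "\<exists>N. splits (P (Suc 0)) N a b"
proof -
  \<comment> \<open>The bounds are premises inside \<open>Q\<close> because \<open>Bolzano\<close>
    also considers intervals that stick out of \<open>[a, b]\<close>.\<close>
  define Q where "Q u v \<longleftrightarrow> (a \<le> u \<longrightarrow> v \<le> b \<longrightarrow> (\<exists>N. splits (P (Suc 0)) N u v))" for u v
  have "Q a b"
    using less_imp_le[OF ab]
  proof (rule Bolzano)
    fix p q r assume "Q p q" "Q q r" "p \<le> q" "q \<le> r"
    then show "Q p r" unfolding Q_def using splits_append by (meson order_trans)
  next
    fix x
    let ?C = "\<Union>{J \<in> D. x \<notin> J}"
    have "closed ?C" using finite_D closed_lap by (intro closed_Union) simp_all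
    then have "open (- ?C)" by (rule open_Compl)
    moreover have "x \<in> - ?C" by blast
    ultimately have "\<exists>d>0. \<forall>y. dist y x < d \<longrightarrow> y \<in> - ?C"
      unfolding open_dist by (rule bspec)
    then obtain d where d: "d > 0" "\<forall>y. dist y x < d \<longrightarrow> y \<in> - ?C"
      by (elim exE conjE)
    have near: "\<exists>J\<in>D. x \<in> J \<and> y \<in> J" if "y \<in> {a..b}" "dist y x < d" for y
    proof -
      from that(1) have "y \<in> \<Union>D" by (simp add: cover)
      then obtain J where J: "J \<in> D" "y \<in> J" by (rule UnionE)
      moreover have "y \<in> - ?C" using d(2)[rule_format, OF that(2)] .
      ultimately have "x \<in> J" by blast
      with J show ?thesis by blast
    qed
    have "\<exists>N. splits (P (Suc 0)) N p q" if pq: "p \<le> x" "x \<le> q" "q - p < d" "a \<le> p" "q \<le> b" for p q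
    proof -
      have "p \<in> {a..b}" "q \<in> {a..b}" "dist p x < d" "dist q x < d"
        using pq by (simp_all add: dist_real_def)
      then obtain J J' where J: "J \<in> D" "x \<in> J" "p \<in> J" and J': "J' \<in> D" "x \<in> J'" "q \<in> J'"
        using near by meson
      have "{p..x} \<subseteq> J" by (rule lap_convex[OF J(1,3,2)])
      moreover have "{x..q} \<subseteq> J'" by (rule lap_convex[OF J'])
      ultimately have "splits (P (Suc 0)) (Suc 0) p x" "splits (P (Suc 0)) (Suc 0) x q"
        unfolding splits_one using P_lap J(1) J'(1) pq(1,2) by blast+
      then show ?thesis using splits_append by blast
    qed
    then show "\<exists>d>0. \<forall>p q. p \<le> x \<and> x \<le> q \<and> q - p < d \<longrightarrow> Q p q"
      unfolding Q_def using d(1) by blast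
  qed
  then show ?thesis by (simp add: Q_def)
qed

lemma splits_exists: "\<exists>N. splits (P n) N a b"
proof (induction n)
  case 0
  have "splits (P 0) (Suc 0) a b" using ab P_zero by (simp add: splits_one)
  then show ?case by blast
next
  case (Suc n)
  then obtain N M where "splits (P n) N a b" "splits (P (Suc 0)) M a b"
    using splits_exists_one by blast
  then show ?case using splits_compose[of n N "Suc 0" M a b] by auto
qed


section \<open>Least numbers of pieces and their exponential growth\<close>

abbreviation count :: "nat \<Rightarrow> real \<Rightarrow> real \<Rightarrow> nat" where
  "count n \<equiv> pieces (P n)"

lemma splits_count:
  assumes "a \<le> p" "p \<le> q" "q \<le> b"
  shows "splits (P n) (count n p q) p q"
proof -
  obtain N where "splits (P n) N a b" using splits_exists by blast
  then have "splits (P n) N p q" using splits_restrict[of n N a b p q] assms by auto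
  then show ?thesis by (rule splits_pieces)
qed

lemma count_mono:
  assumes "a \<le> p" "p \<le> p'" "p' \<le> q'" "q' \<le> q" "q \<le> b"
  shows "count n p' q' \<le> count n p q"
  by (intro pieces_le splits_restrict[OF splits_count[of p q]]) (use assms in auto)

lemma count_add_le:
  assumes "a \<le> u" "u \<le> v" "v \<le> w" "w \<le> b"
  shows "count n u w \<le> count n u v + count n v w"
  by (intro pieces_le splits_append[OF splits_count splits_count]) (use assms in auto)

lemma count_add_ge:
  assumes "a \<le> u" "u \<le> v" "v \<le> w" "w \<le> b"
  shows "count n u v + count n v w \<le> Suc (count n u w)"
proof -
  have "splits (P n) (count n u w) u w" by (intro splits_count) (use assms in auto)
  then obtain M M' where M: "M + M' \<le> Suc (count n u w)" "splits (P n) M u v" "splits (P n) M' v w"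
    using splits_cut[where P = "P n"] P_subinterval assms(2,3) by meson
  then show ?thesis using pieces_le[OF M(2)] pieces_le[OF M(3)] by linarith
qed

lemma count_pos: "0 < count n a b"
  using splits_count[of a b n] ab by (cases "count n a b") auto

lemma count_submultiplicative: "count (k + n) a b \<le> count k a b * Suc (count n a b)"
  by (intro pieces_le splits_compose splits_count) (use ab in auto)

lemma count_zero_le: "p \<le> q \<Longrightarrow> count 0 p q \<le> 1"
  using pieces_le[of "P 0" "Suc 0" p q] by (simp add: splits_one P_zero)

text \<open>The entropy is a \<open>lim\<close>, so convergence has to be proved before its value
  can be used. Fekete's lemma applies to \<open>ln (1 + count)\<close>, where the 1 absorbs the
  shift in \<open>count_submultiplicative\<close>; the factor linear in \<open>n\<close> between
  counts and lap numbers disappears when its logarithm is divided by \<open>n\<close>.\<close>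

lemma
  fixes \<beta> :: real
  assumes "0 < \<beta>" "topological_entropy a b f D = ln \<beta>"
  shows count_growth: "(\<lambda>n. ln (1 + real (count n a b)) / n) \<longlonglongrightarrow> ln \<beta>"
    and count_ge: "\<beta> ^ n \<le> 1 + real (count n a b)"
proof -
  define s where "s n = ln (1 + real (count n a b))" for n
  have "s (k + n) \<le> s k + s n" for k n
  proof -
    have "real (count (k + n) a b) \<le> real (count k a b * Suc (count n a b))"
      unfolding of_nat_le_iff by (rule count_submultiplicative)
    then have "1 + real (count (k + n) a b) \<le> (1 + real (count k a b)) * (1 + real (count n a b))"
      by (simp add: algebra_simps)
    then have "s (k + n) \<le> ln ((1 + real (count k a b)) * (1 + real (count n a b)))"
      unfolding s_def by (intro ln_mono) (auto intro: add_pos_nonneg)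
    also have "\<dots> = s k + s n"
      unfolding s_def by (intro ln_mult_pos) (auto intro: add_pos_nonneg)
    finally show ?thesis .
  qed
  moreover have "0 \<le> s n" for n by (simp add: s_def)
  ultimately obtain L where L: "(\<lambda>n. s n / n) \<longlonglongrightarrow> L" "\<And>n. 0 < n \<Longrightarrow> L * n \<le> s n"
    using subadditive_average_converges[of s] by blast
  define c where "c n = lap_number a b f D n" for n
  define W where "W = 1 + real (card endpoint_values)"
  have W: "W > 0" by (simp add: W_def)
  have lower: "s n - ln 2 \<le> ln (c n)" and upper: "ln (c n) \<le> s n + ln (2 * (1 + n * W))" for n
  proof -
    have sp: "splits (P n) (count n a b) a b" using splits_count ab by simp
    have 1: "count n a b \<le> c n"
      unfolding c_def by (rule pieces_le[OF splits_lap_number[OF sp]])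
    then have c: "0 < c n" using count_pos[of n] by simp
    \<comment> \<open>The factor 2 pays for the summand 1, since \<open>c n\<close> is at least 1;
      it becomes the \<open>ln 2\<close> of the lower bound.\<close>
    have "1 + real (count n a b) \<le> 2 * c n" using 1 c by simp
    then have "s n \<le> ln (2 * c n)" unfolding s_def by (intro ln_mono) (auto intro: add_pos_nonneg)
    then show "s n - ln 2 \<le> ln (c n)" using c by (simp add: ln_mult_pos)
    have "real (c n) \<le> real (Suc (count n a b) * (2 * (1 + n * card endpoint_values)))"
      unfolding c_def of_nat_le_iff by (rule lap_number_le[OF sp])
    also have "\<dots> = (1 + real (count n a b)) * (2 * (1 + n * real (card endpoint_values)))"
      by (simp add: algebra_simps)
    also have "\<dots> \<le> (1 + real (count n a b)) * (2 * (1 + n * W))"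
      by (intro mult_left_mono add_left_mono) (auto simp: W_def)
    finally have "ln (c n) \<le> ln ((1 + real (count n a b)) * (2 * (1 + n * W)))"
      using c by (intro ln_mono) auto
    also have "\<dots> = s n + ln (2 * (1 + n * W))"
      unfolding s_def using W by (intro ln_mult_pos) (auto intro: add_pos_nonneg)
    finally show "ln (c n) \<le> s n + ln (2 * (1 + n * W))" .
  qed
  have "(\<lambda>n. ln (c n) / n) \<longlonglongrightarrow> L"
  proof (rule tendsto_sandwich)
    have "(\<lambda>n::nat. ln 2 / n) \<longlonglongrightarrow> 0" by (rule lim_const_over_n)
    from tendsto_diff[OF L(1) this] show "(\<lambda>n. (s n - ln 2) / n) \<longlonglongrightarrow> L"
      by (simp add: diff_divide_distrib)
    have "(\<lambda>n::nat. ln (2 * (1 + n * W)) / n) \<longlonglongrightarrow> 0" using W by real_asymp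
    from tendsto_add[OF L(1) this] show "(\<lambda>n. (s n + ln (2 * (1 + n * W))) / n) \<longlonglongrightarrow> L"
      by (simp add: add_divide_distrib)
  qed (intro always_eventually allI divide_right_mono lower upper of_nat_0_le_iff)+
  then have "topological_entropy a b f D = L"
    unfolding topological_entropy_def c_def by (rule limI)
  then have L_eq: "L = ln \<beta>" using assms by simp
  show "(\<lambda>n. ln (1 + real (count n a b)) / n) \<longlonglongrightarrow> ln \<beta>"
    using L(1) unfolding L_eq s_def by simp
  show "\<beta> ^ n \<le> 1 + real (count n a b)"
  proof (cases "n = 0")
    case False
    have "ln (\<beta> ^ n) \<le> ln (1 + real (count n a b))"
      using L(2)[of n] False assms(1) unfolding L_eq s_def by (simp add: ln_realpow mult.commute)
    then show ?thesis using assms(1) by (subst (asm) ln_le_cancel_iff) (auto intro: add_pos_nonneg)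
  qed simp
qed


subsection \<open>The image of an interval inside a lap\<close>

lemma V_branch:
  assumes J: "J \<in> D" "t \<in> interior J"
  shows "V (Suc n) t = V n (branch f J t)"
proof -
  have "{J' \<in> D. t \<in> J'} = {J}"
    using lap_unique[OF J(1) _ J(2)] J interior_subset by blast
  then show ?thesis unfolding V_Suc_left by simp
qed

text \<open>At an endpoint of \<open>J\<close> the value of \<open>F\<close> might come from the
  branch of a neighbouring lap. Interior points admit only the branch of \<open>J\<close>, and the
  closed graph carries the relation over to the endpoints, because \<open>F\<close> and the branch
  are continuous there.\<close>

lemma value_on_branch:
  assumes J: "J \<in> D" and xy: "x < y" "{x..y} \<subseteq> J" and F: "selection R (Suc n) {x..y} F" and t: "t \<in> {x..y}"
  shows "F t \<in> V n (branch f J t)"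
proof -
  obtain u v where uv: "J = {u..v}" "a \<le> u" "v \<le> b" using lap_interval[OF J] by metis
  have int: "{x<..<y} \<subseteq> interior J" using xy uv by auto
  show ?thesis
  proof (rule value_graph_limit)
    show "at t within {x<..<y} \<noteq> bot" by (rule at_within_Ioo_neq_bot[OF xy(1) t])
    have sub: "{x<..<y} \<subseteq> {x..y}" by auto
    have "(branch f J \<longlongrightarrow> branch f J t) (at t within J)"
      using branch_continuous[OF J] t xy(2) unfolding continuous_on_def by blast
    then show "(branch f J \<longlongrightarrow> branch f J t) (at t within {x<..<y})"
      by (rule tendsto_within_subset) (use sub xy(2) in blast)
    have "(F \<longlongrightarrow> F t) (at t within {x..y})"
      using F t unfolding selection_def continuous_on_def by blast
    then show "(F \<longlongrightarrow> F t) (at t within {x<..<y})"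
      by (rule tendsto_within_subset) (use sub in blast)
    have "branch f J s \<in> {a..b} \<and> F s \<in> V n (branch f J s)" if s: "s \<in> {x<..<y}" for s
    proof -
      have "F s \<in> V (Suc n) s" using F s sub unfolding selection_def by blast
      moreover have "s \<in> J" using s sub xy(2) by blast
      ultimately show ?thesis
        using V_branch[OF J, of s n] s int branch_range[OF J] by blast
    qed
    then show "\<forall>\<^sub>F s in at t within {x<..<y}. branch f J s \<in> {a..b} \<and> F s \<in> V n (branch f J s)"
      by (simp add: eventually_at_filter)
  qed
qed

text \<open>A selection \<open>F\<close> of \<open>f^(n+1)\<close> factors as \<open>G\<close> after
  the branch. On a fibre of the branch, an interval by monotonicity, \<open>F\<close> is continuous
  and has only the finitely many values of \<open>f^n\<close> at one point to choose from, so it is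
  constant.\<close>

lemma P_branch_image:
  assumes J: "J \<in> D" and xy: "x \<le> y" "{x..y} \<subseteq> J" and Pxy: "P (Suc n) {x..y}"
  shows "P n (branch f J ` {x..y})"
proof (cases "x = y")
  case True
  then show ?thesis
    using branch_range[OF J] xy by (auto intro!: P_singleton simp del: atLeastAtMost_iff)
next
  case False
  then have less: "x < y" using xy by simp
  let ?h = "branch f J" and ?Q = "{x..y}"
  obtain R F where R: "directed R" and F: "selection R (Suc n) ?Q F"
    using Pxy unfolding P_iff by blast
  obtain S where S: "directed S" "monotone_on J (\<le>) S ?h"
    using branch_monotonic[OF J] unfolding monotonic_on_iff by blast
  have hc: "continuous_on ?Q ?h" using continuous_on_subset[OF branch_continuous[OF J] xy(2)] .
  have hm: "monotone_on ?Q (\<le>) S ?h" using monotone_on_subset[OF S(2) xy(2)] .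
  have Fc: "continuous_on ?Q F" and Fm: "monotone_on ?Q (\<le>) R F"
    using F by (simp_all add: selection_def)
  have FV: "F t \<in> V n (?h t)" if "t \<in> ?Q" for t
    using value_on_branch[OF J less xy(2) F that] .
  have fib: "F s = F t" if st: "s \<in> ?Q" "t \<in> ?Q" "s \<le> t" "?h s = ?h t" for s t
  proof -
    have sub: "{s..t} \<subseteq> ?Q" using st by auto
    have "?h r = ?h s" if r: "r \<in> {s..t}" for r
    proof -
      have "r \<in> ?Q" "s \<le> r" "r \<le> t" using r sub by auto
      then have hr: "S (?h s) (?h r)" "S (?h r) (?h t)"
        using hm st(1,2) unfolding monotone_on_def by blast+
      from S(1) show ?thesis
      proof
        assume "S = (\<le>)"
        then show ?thesis using hr st(4) by (simp only: order_antisym)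
      next
        assume "S = (\<ge>)"
        then show ?thesis using hr st(4) by (simp only: order_antisym)
      qed
    qed
    then have "F r \<in> V n (?h s)" if "r \<in> {s..t}" for r
      using FV[of r] sub that by (metis subsetD)
    then have "F ` {s..t} \<subseteq> V n (?h s)" by (rule image_subsetI)
    then have "finite (F ` {s..t})" using V_finite finite_subset by blast
    then have "F constant_on {s..t}"
      using continuous_finite_range_constant[of "{s..t}" F] continuous_on_subset[OF Fc sub] by auto
    then show ?thesis using st(3) unfolding constant_on_def by auto
  qed
  have fib': "F s = F t" if "s \<in> ?Q" "t \<in> ?Q" "?h s = ?h t" for s t
    using fib[OF that(1,2)] fib[OF that(2,1)] that(3) by (metis linear)
  define G where "G y = F (SOME t. t \<in> ?Q \<and> ?h t = y)" for y
  have G: "G (?h t) = F t" if "t \<in> ?Q" for t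
  proof -
    have "(SOME r. r \<in> ?Q \<and> ?h r = ?h t) \<in> ?Q \<and> ?h (SOME r. r \<in> ?Q \<and> ?h r = ?h t) = ?h t"
      by (rule someI[of _ t]) (use that in simp)
    then show ?thesis unfolding G_def using fib' that by blast
  qed
  \<comment> \<open>On a compact interval the branch maps closed sets to closed sets, so continuity
    of \<open>F\<close> descends to \<open>G\<close>.\<close>
  have "continuous_on (?h ` ?Q) G"
  proof (subst continuous_on_closed_vimage)
    show "closed (?h ` ?Q)" by (intro compact_imp_closed compact_continuous_image hc) simp
    show "\<forall>B. closed B \<longrightarrow> closed (G -` B \<inter> ?h ` ?Q)"
    proof (intro allI impI)
      fix B :: "real set" assume "closed B"
      then have "closed (F -` B \<inter> ?Q)"
        using Fc by (simp add: continuous_on_closed_vimage)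
      then have "compact (F -` B \<inter> ?Q)"
        by (metis compact_Int_closed compact_Icc inf.right_idem inf_commute)
      then have "compact (?h ` (F -` B \<inter> ?Q))"
        by (rule compact_continuous_image[rotated]) (rule continuous_on_subset[OF hc], simp)
      moreover have "G -` B \<inter> ?h ` ?Q = ?h ` (F -` B \<inter> ?Q)" using G by auto
      ultimately show "closed (G -` B \<inter> ?h ` ?Q)" by (simp add: compact_imp_closed)
    qed
  qed
  moreover define T where "T = (if S = (\<le>) then R else (\<lambda>x y. R y x))"
  have "monotone_on (?h ` ?Q) (\<le>) T G"
  proof (rule monotone_onI)
    fix p q assume "p \<in> ?h ` ?Q" "q \<in> ?h ` ?Q" and pq: "p \<le> q"
    then obtain s t where st: "p = ?h s" "q = ?h t" "s \<in> ?Q" "t \<in> ?Q" by blast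
    have FR: "R (F r) (F r')" if "r \<in> ?Q" "r' \<in> ?Q" "r \<le> r'" for r r'
      using Fm that unfolding monotone_on_def by blast
    have hS: "S (?h r) (?h r')" if "r \<in> ?Q" "r' \<in> ?Q" "r \<le> r'" for r r'
      using hm that unfolding monotone_on_def by blast
    have "T (F s) (F t)"
    proof (cases "p = q")
      case True
      then have "F s = F t" using fib'[OF st(3,4)] st(1,2) by simp
      then show ?thesis using directed_order(1)[OF R] by (simp add: T_def)
    next
      case False
      show ?thesis
      proof (cases "S = (\<le>)")
        case True
        have "s \<le> t"
        proof (rule ccontr)
          assume "\<not> s \<le> t"
          then have "S (?h t) (?h s)" using hS[OF st(4,3)] by linarith
          then show False using True False pq unfolding st(1,2) by (simp only: order_antisym)
        qed
        then show ?thesis using FR[OF st(3,4)] True unfolding T_def by simp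
      next
        case ne: False
        then have Sge: "S = (\<ge>)" using S(1) by blast
        have "t \<le> s"
        proof (rule ccontr)
          assume "\<not> t \<le> s"
          then have "S (?h s) (?h t)" using hS[OF st(3,4)] by linarith
          then show False using Sge False pq unfolding st(1,2) by (simp only: order_antisym)
        qed
        then show ?thesis using FR[OF st(4,3)] ne by (simp add: T_def)
      qed
    qed
    then show "T (G p) (G q)" using G st by simp
  qed
  moreover have "directed T" using R by (auto simp: T_def)
  moreover have "G q \<in> V n q" if "q \<in> ?h ` ?Q" for q
    using that G FV by auto
  ultimately show ?thesis unfolding P_iff selection_def by blast
qed

lemma branch_interval_image:
  assumes J: "J \<in> D" and xy: "x \<le> y" "{x..y} \<subseteq> J"
  shows "{min (branch f J x) (branch f J y)..max (branch f J x) (branch f J y)} \<subseteq> branch f J ` {x..y}"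
proof
  fix c assume c: "c \<in> {min (branch f J x) (branch f J y)..max (branch f J x) (branch f J y)}"
  have cont: "continuous_on {x..y} (branch f J)"
    using continuous_on_subset[OF branch_continuous[OF J] xy(2)] .
  have "\<exists>t. x \<le> t \<and> t \<le> y \<and> branch f J t = c"
  proof (cases "branch f J x \<le> branch f J y")
    case True
    then show ?thesis using IVT'[of "branch f J" x c y] c xy cont by simp
  next
    case False
    then show ?thesis using IVT2'[of "branch f J" y c x] c xy cont by simp
  qed
  then show "c \<in> branch f J ` {x..y}" by auto
qed

lemma P_branch_interval:
  assumes "J \<in> D" "x \<le> y" "{x..y} \<subseteq> J" "P (Suc n) {x..y}"
  shows "P n {min (branch f J x) (branch f J y)..max (branch f J x) (branch f J y)}"
  using P_subset[OF P_branch_image branch_interval_image] assms by blast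

text \<open>Pieces map forward to pieces without loss; a decreasing branch reverses their order, so
  there the first piece is appended at the right end.\<close>

lemma splits_branch_image:
  assumes J: "J \<in> D"
  shows "splits (P (Suc n)) N x y \<Longrightarrow> {x..y} \<subseteq> J \<Longrightarrow>
    splits (P n) N (min (branch f J x) (branch f J y)) (max (branch f J x) (branch f J y))"
proof (induction N arbitrary: x)
  case (Suc N)
  let ?h = "branch f J"
  obtain z where z: "x \<le> z" "z \<le> y" "P (Suc n) {x..z}" "splits (P (Suc n)) N z y"
    using Suc.prems by auto
  have sub: "{x..z} \<subseteq> J" "{z..y} \<subseteq> J" using z Suc.prems(2) by auto
  have in_J: "x \<in> J" "y \<in> J" "z \<in> J" using z Suc.prems(2) by auto
  have Pz: "P n {min (?h x) (?h z)..max (?h x) (?h z)}"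
    using P_branch_interval[OF J z(1) sub(1) z(3)] .
  have IH: "splits (P n) N (min (?h z) (?h y)) (max (?h z) (?h y))"
    using Suc.IH[OF z(4) sub(2)] .
  from branch_monotonic[OF J] consider "mono_on J ?h" | "antimono_on J ?h"
    unfolding monotonic_on_def by blast
  then show ?case
  proof cases
    case 1
    then have "?h x \<le> ?h z" "?h z \<le> ?h y" using in_J z by (auto simp: monotone_on_def)
    then show ?thesis using Pz IH by (auto simp: min_def max_def)
  next
    case 2
    then have h: "?h z \<le> ?h x" "?h y \<le> ?h z" using in_J z by (auto simp: monotone_on_def)
    then have "splits (P n) (Suc 0) (?h z) (?h x)" "splits (P n) N (?h y) (?h z)"
      using Pz IH by (simp_all add: splits_one min_absorb2 max_absorb1)
    then have "splits (P n) (N + Suc 0) (?h y) (?h x)" using splits_append by blast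
    moreover have "?h y \<le> ?h x" using h by simp
    ultimately show ?thesis by (simp del: splits.simps add: min_absorb2 max_absorb1)
  qed
qed simp

definition image_count :: "real set \<Rightarrow> nat \<Rightarrow> real \<Rightarrow> real \<Rightarrow> nat" where
  "image_count J n x y = count n (min (branch f J x) (branch f J y)) (max (branch f J x) (branch f J y))"

text \<open>The 1 in the upper bound arises in pulling back and is there for a constant branch,
  whose image needs 0 pieces.\<close>

lemma count_branch:
  assumes J: "J \<in> D" "x \<in> J" "y \<in> J" "x \<le> y"
  shows "image_count J n x y \<le> count (Suc n) x y" "count (Suc n) x y \<le> Suc (image_count J n x y)"
proof -
  let ?h = "branch f J"
  have xy: "x \<in> {a..b}" "y \<in> {a..b}" using J lap_subset by blast+
  have hxy: "?h x \<in> {a..b}" "?h y \<in> {a..b}" using J branch_range by blast+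
  have sub: "{x..y} \<subseteq> J" using lap_convex[OF J(1-3)] .
  show "image_count J n x y \<le> count (Suc n) x y"
    unfolding image_count_def
    by (intro pieces_le splits_branch_image[OF J(1) _ sub] splits_count) (use xy J in auto)
  obtain R where R: "directed R" "selection R (Suc 0) J ?h" "monotone_on J (\<le>) R ?h"
    using branch_selection[OF J(1)] .
  have sel: "selection R (Suc 0) {x..y} ?h" using selection_subset[OF R(2) sub] .
  have ab: "{x..y} \<subseteq> {a..b}" using xy by auto
  have sp: "splits (P n) (image_count J n x y) (min (?h x) (?h y)) (max (?h x) (?h y))"
    unfolding image_count_def by (intro splits_count) (use hxy in auto)
  have "splits (P (Suc 0 + n)) (Suc (image_count J n x y)) x y"
    using R(1)
  proof
    assume Req: "R = (\<le>)"
    then have "?h x \<le> ?h y" using R(3) J by (simp add: monotone_on_def)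
    then show ?thesis
      using splits_preimage_mono[OF sel[unfolded Req] J(4) ab] sp by (simp del: splits.simps)
  next
    assume Req: "R = (\<ge>)"
    then have "?h y \<le> ?h x" using R(3) J by (simp add: monotone_on_def)
    then show ?thesis
      using splits_preimage_antimono[OF sel[unfolded Req] J(4) ab] sp
      by (simp del: splits.simps add: min_absorb2 max_absorb1)
  qed
  then show "count (Suc n) x y \<le> Suc (image_count J n x y)"
    by (intro pieces_le) (simp del: splits.simps)
qed

end

subsection \<open>The generating function and its limit at the radius of convergence\<close>

text \<open>Any \<open>\<gamma>\<close> strictly between \<open>\<beta>\<close> and
  \<open>1 / t\<close> works, here the midpoint: \<open>c n\<close> is eventually below
  \<open>\<gamma> ^ n\<close>, and \<open>\<gamma> * t < 1\<close>.\<close>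

lemma geometric_dominated:
  fixes c :: "nat \<Rightarrow> nat" and t \<beta> :: real
  assumes t: "0 < t" "t < 1 / \<beta>" and \<beta>: "0 < \<beta>" and lim: "(\<lambda>n. ln (1 + real (c n)) / n) \<longlonglongrightarrow> ln \<beta>"
  shows "summable (\<lambda>n. real (c n) * t ^ n)"
proof -
  define \<gamma> where "\<gamma> = (\<beta> + 1 / t) / 2"
  have "\<beta> < 1 / t" using t \<beta> by (simp add: field_simps)
  then have \<gamma>: "\<beta> < \<gamma>" "\<gamma> < 1 / t" by (simp_all add: \<gamma>_def)
  then have \<gamma>t: "0 < \<gamma>" "\<gamma> * t < 1" using t \<beta> by (simp_all add: field_simps)
  have "ln \<beta> < ln \<gamma>" using \<gamma> \<gamma>t \<beta> by simp
  then have "\<forall>\<^sub>F n in sequentially. ln (1 + real (c n)) / n < ln \<gamma>" by (rule order_tendstoD(2)[OF lim])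
  then have "\<forall>\<^sub>F n in sequentially. norm (real (c n) * t ^ n) \<le> (\<gamma> * t) ^ n"
    using eventually_gt_at_top[of 0]
  proof eventually_elim
    case (elim n)
    then have "ln (1 + real (c n)) < ln (\<gamma> ^ n)"
      using \<gamma>t by (simp add: ln_realpow field_simps)
    then have "1 + real (c n) < \<gamma> ^ n"
      using \<gamma>t by (subst (asm) ln_less_cancel_iff) (auto intro: add_pos_nonneg)
    then have "real (c n) * t ^ n \<le> \<gamma> ^ n * t ^ n"
      using t by (intro mult_right_mono) auto
    then show ?case using t by (simp add: power_mult_distrib)
  qed
  then show ?thesis
    by (rule summable_comparison_test_ev) (use \<gamma>t t in \<open>auto intro!: summable_geometric\<close>)
qed

lemma tendsto_of_error:
  fixes F F' e :: "real \<Rightarrow> real"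
  assumes "(F \<longlongrightarrow> l) G" "(e \<longlongrightarrow> 0) G" "\<forall>\<^sub>F t in G. \<bar>F' t - F t\<bar> \<le> e t"
  shows "(F' \<longlongrightarrow> l) G"
proof -
  have "((\<lambda>t. F' t - F t) \<longlongrightarrow> 0) G"
    by (rule Lim_null_comparison[OF _ assms(2)]) (use assms(3) in simp)
  from tendsto_add[OF this assms(1)] show ?thesis by simp
qed

lemma abs_divide_le: "\<bar>x\<bar> \<le> e \<Longrightarrow> 0 < y \<Longrightarrow> \<bar>x / y\<bar> \<le> e / y" for x y e :: real
  by (simp add: divide_right_mono)

locale positive_entropy = piecewise_monotone +
  fixes \<beta> :: real
  assumes \<beta>: "1 < \<beta>" and entropy: "topological_entropy a b f D = ln \<beta>"
begin

definition gen :: "real \<Rightarrow> real \<Rightarrow> real \<Rightarrow> real" where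
  "gen t x y = (\<Sum>n. real (count n x y) * t ^ n)"

definition admissible :: "real \<Rightarrow> bool" where
  "admissible t \<longleftrightarrow> 0 < t \<and> t < 1 / \<beta>"

lemma admissible_less_one:
  assumes "admissible t"
  shows "0 < t" "t < 1"
proof -
  have "1 / \<beta> < 1" using \<beta> by simp
  then show "0 < t" "t < 1" using assms unfolding admissible_def by linarith+
qed

lemma summable_gen:
  assumes t: "admissible t" and xy: "a \<le> x" "x \<le> y" "y \<le> b"
  shows "summable (\<lambda>n. real (count n x y) * t ^ n)"
proof (rule summable_comparison_test')
  show "summable (\<lambda>n. real (count n a b) * t ^ n)"
    using geometric_dominated[OF _ _ _ count_growth[OF _ entropy]] t \<beta> by (simp add: admissible_def)
  show "norm (real (count n x y) * t ^ n) \<le> real (count n a b) * t ^ n" for n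
    using count_mono[of a x y b n] xy admissible_less_one[OF t] by (simp add: mult_right_mono)
qed

lemma
  assumes "admissible t"
  shows summable_power: "summable (\<lambda>n. t ^ n)" and sum_power: "(\<Sum>n. t ^ n) = 1 / (1 - t)"
  using admissible_less_one[OF assms] by (simp_all add: summable_geometric suminf_geometric)

lemma gen_nonneg: "admissible t \<Longrightarrow> a \<le> x \<Longrightarrow> x \<le> y \<Longrightarrow> y \<le> b \<Longrightarrow> 0 \<le> gen t x y"
  unfolding gen_def using admissible_less_one[of t] by (intro suminf_nonneg summable_gen) auto

lemma gen_mono:
  assumes t: "admissible t" and xy: "a \<le> x" "x \<le> y" "y \<le> z" "z \<le> b"
  shows "gen t x y \<le> gen t x z"
  unfolding gen_def
  by (intro suminf_le summable_gen mult_right_mono of_nat_mono count_mono)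
    (use assms admissible_less_one[OF t] in auto)

text \<open>The discrepancy of at most 1 in each count sums to the geometric series
  \<open>1 / (1 - t)\<close>.\<close>

lemma gen_add:
  assumes t: "admissible t" and uvw: "a \<le> u" "u \<le> v" "v \<le> w" "w \<le> b"
  shows "gen t u w \<le> gen t u v + gen t v w" "gen t u v + gen t v w \<le> gen t u w + 1 / (1 - t)"
proof -
  have t0: "0 \<le> t ^ n" for n using admissible_less_one[OF t] by simp
  have s: "summable (\<lambda>n. real (count n u v) * t ^ n)" "summable (\<lambda>n. real (count n v w) * t ^ n)"
    "summable (\<lambda>n. real (count n u w) * t ^ n)"
    using summable_gen[OF t] uvw by auto
  have eq: "gen t u v + gen t v w = (\<Sum>n. real (count n u v) * t ^ n + real (count n v w) * t ^ n)"
    unfolding gen_def by (rule suminf_add[OF s(1,2)])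
  have eq': "gen t u w + 1 / (1 - t) = (\<Sum>n. real (count n u w) * t ^ n + t ^ n)"
    unfolding gen_def sum_power[OF t, symmetric] by (rule suminf_add[OF s(3) summable_power[OF t]])
  have "real (count n u w) * t ^ n \<le> real (count n u v) * t ^ n + real (count n v w) * t ^ n" for n
  proof -
    have "real (count n u w) \<le> real (count n u v) + real (count n v w)"
      using count_add_le[OF uvw, of n] by linarith
    from mult_right_mono[OF this t0[of n]] show ?thesis by (simp add: distrib_right)
  qed
  then show "gen t u w \<le> gen t u v + gen t v w"
    unfolding eq unfolding gen_def by (intro suminf_le summable_add s)
  have "real (count n u v) * t ^ n + real (count n v w) * t ^ n \<le> real (count n u w) * t ^ n + t ^ n" for n
  proof -
    have "real (count n u v) + real (count n v w) \<le> real (count n u w) + 1"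
      using count_add_ge[OF uvw, of n] by linarith
    from mult_right_mono[OF this t0[of n]] show ?thesis by (simp add: distrib_right)
  qed
  then show "gen t u v + gen t v w \<le> gen t u w + 1 / (1 - t)"
    unfolding eq eq' by (intro suminf_le summable_add s summable_power[OF t])
qed

text \<open>The index shift from \<open>Suc n\<close> to \<open>n\<close> becomes the factor
  \<open>t\<close>. The error consists of at most 1 for the term of \<open>f^0\<close> and of
  \<open>t / (1 - t)\<close> for all others, together again \<open>1 / (1 - t)\<close>.\<close>

lemma gen_branch:
  assumes t: "admissible t" and J: "J \<in> D" "x \<in> J" "y \<in> J" "x \<le> y"
  defines "p \<equiv> min (branch f J x) (branch f J y)" and "q \<equiv> max (branch f J x) (branch f J y)"
  shows "t * gen t p q \<le> gen t x y" "gen t x y \<le> t * gen t p q + 1 / (1 - t)"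
proof -
  have t1: "0 < t" "t < 1" using admissible_less_one[OF t] by auto
  have t0: "0 \<le> t ^ n" for n using t1 by simp
  have xy: "x \<in> {a..b}" "y \<in> {a..b}" using J lap_subset by blast+
  have hxy: "branch f J x \<in> {a..b}" "branch f J y \<in> {a..b}" using J branch_range by blast+
  have cnt: "count n p q \<le> count (Suc n) x y" "count (Suc n) x y \<le> Suc (count n p q)" for n
    using count_branch[OF J, of n] unfolding image_count_def p_def q_def by auto
  have s: "summable (\<lambda>n. real (count n x y) * t ^ n)" using summable_gen[OF t] xy J by auto
  have s': "summable (\<lambda>n. real (count n p q) * t ^ n)"
    using summable_gen[OF t] hxy unfolding p_def q_def by auto
  have sS: "summable (\<lambda>n. real (count (Suc n) x y) * t ^ Suc n)" using s by (subst summable_Suc_iff)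
  have head: "gen t x y = count 0 x y + (\<Sum>n. real (count (Suc n) x y) * t ^ Suc n)"
    using suminf_split_head[OF s] by (simp add: gen_def)
  have tgen: "t * gen t p q = (\<Sum>n. t * (real (count n p q) * t ^ n))"
    unfolding gen_def by (rule suminf_mult[OF s', symmetric])
  have "t * (real (count n p q) * t ^ n) \<le> real (count (Suc n) x y) * t ^ Suc n" for n
  proof -
    have "real (count n p q) * t ^ Suc n \<le> real (count (Suc n) x y) * t ^ Suc n"
      by (intro mult_right_mono t0 of_nat_mono cnt)
    then show ?thesis by (simp add: ac_simps)
  qed
  then have "t * gen t p q \<le> (\<Sum>n. real (count (Suc n) x y) * t ^ Suc n)"
    unfolding tgen by (intro suminf_le summable_mult s' sS)
  then show "t * gen t p q \<le> gen t x y" unfolding head by simp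
  have "real (count (Suc n) x y) * t ^ Suc n \<le> t * (real (count n p q) * t ^ n) + t * t ^ n" for n
  proof -
    have "real (count (Suc n) x y) \<le> real (count n p q) + 1" using cnt(2)[of n] by linarith
    from mult_right_mono[OF this t0[of "Suc n"]] show ?thesis by (simp add: algebra_simps)
  qed
  then have "(\<Sum>n. real (count (Suc n) x y) * t ^ Suc n) \<le> (\<Sum>n. t * (real (count n p q) * t ^ n) + t * t ^ n)"
    by (intro suminf_le summable_add summable_mult s' sS summable_power[OF t])
  also have "\<dots> = t * gen t p q + t * (1 / (1 - t))"
    unfolding tgen sum_power[OF t, symmetric] suminf_mult[OF summable_power[OF t], symmetric]
    by (intro suminf_add[symmetric] summable_mult s' summable_power[OF t])
  finally have "gen t x y \<le> 1 + (t * gen t p q + t * (1 / (1 - t)))"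
    unfolding head using count_zero_le[OF J(4)] by linarith
  also have "\<dots> = t * gen t p q + 1 / (1 - t)" using t1 by (simp add: field_simps)
  finally show "gen t x y \<le> t * gen t p q + 1 / (1 - t)" .
qed

lemma eventually_admissible: "\<forall>\<^sub>F t in at_left (1 / \<beta>). admissible t"
  unfolding admissible_def using eventually_at_left_real[of 0 "1 / \<beta>"] \<beta>
  by (auto elim!: eventually_mono)

text \<open>This sums \<open>count_ge\<close>, which holds for every \<open>n\<close>; the growth
  rate alone would not force divergence at \<open>1 / \<beta>\<close>.\<close>

lemma gen_lower:
  assumes t: "admissible t"
  shows "1 / (1 - \<beta> * t) - 1 / (1 - t) \<le> gen t a b"
proof -
  have t1: "0 < t" "t < 1" "\<beta> * t < 1"
    using admissible_less_one[OF t] t \<beta> by (auto simp: admissible_def field_simps)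
  have s: "summable (\<lambda>n. (\<beta> * t) ^ n)" using t1 \<beta> by (intro summable_geometric) auto
  have "(\<beta> * t) ^ n - t ^ n \<le> real (count n a b) * t ^ n" for n
  proof -
    have "\<beta> ^ n - 1 \<le> real (count n a b)"
      using count_ge[OF _ entropy, of n] \<beta> by simp
    from mult_right_mono[OF this, of "t ^ n"] show ?thesis
      using t1 by (simp add: algebra_simps power_mult_distrib)
  qed
  then have "(\<Sum>n. (\<beta> * t) ^ n - t ^ n) \<le> gen t a b"
    unfolding gen_def using ab
    by (intro suminf_le summable_diff s summable_power[OF t] summable_gen[OF t]) auto
  moreover have "(\<Sum>n. (\<beta> * t) ^ n - t ^ n) = (\<Sum>n. (\<beta> * t) ^ n) - (\<Sum>n. t ^ n)"
    by (rule suminf_diff[symmetric, OF s summable_power[OF t]])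
  moreover have "(\<Sum>n. (\<beta> * t) ^ n) = 1 / (1 - \<beta> * t)"
    using t1 \<beta> by (intro suminf_geometric) auto
  ultimately show ?thesis using sum_power[OF t] by simp
qed

lemma gen_at_top: "filterlim (\<lambda>t. gen t a b) at_top (at_left (1 / \<beta>))"
proof (rule filterlim_at_top_mono)
  have "((\<lambda>t. 1 - \<beta> * t) \<longlongrightarrow> 1 - \<beta> * (1 / \<beta>)) (at_left (1 / \<beta>))"
    by (intro tendsto_intros)
  then have "((\<lambda>t. 1 - \<beta> * t) \<longlongrightarrow> 0) (at_left (1 / \<beta>))" using \<beta> by simp
  moreover have "\<forall>\<^sub>F t in at_left (1 / \<beta>). 1 - \<beta> * t > 0"
    using eventually_admissible by eventually_elim (use \<beta> in \<open>simp add: admissible_def field_simps\<close>)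
  ultimately have "filterlim (\<lambda>t. 1 - \<beta> * t) (at_right 0) (at_left (1 / \<beta>))"
    by (simp add: filterlim_at eventually_mono)
  then have "filterlim (\<lambda>t. inverse (1 - \<beta> * t)) at_top (at_left (1 / \<beta>))"
    by (rule filterlim_compose[OF filterlim_inverse_at_top_right])
  from filterlim_tendsto_add_at_top[OF tendsto_const[of "- (1 / (1 - 1 / \<beta>))"] this]
  show "filterlim (\<lambda>t. 1 / (1 - \<beta> * t) - 1 / (1 - 1 / \<beta>)) at_top (at_left (1 / \<beta>))"
    by (simp add: inverse_eq_divide)
  show "\<forall>\<^sub>F t in at_left (1 / \<beta>). 1 / (1 - \<beta> * t) - 1 / (1 - 1 / \<beta>) \<le> gen t a b"
    using eventually_admissible
  proof eventually_elim
    case (elim t)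
    have "1 / \<beta> < 1" using \<beta> by simp
    then have "1 / (1 - t) \<le> 1 / (1 - 1 / \<beta>)"
      using elim unfolding admissible_def by (intro divide_left_mono mult_pos_pos) linarith+
    then show ?case using gen_lower[OF elim] by linarith
  qed
qed

lemma error_tendsto_zero: "((\<lambda>t. (1 / (1 - t)) / gen t a b) \<longlongrightarrow> 0) (at_left (1 / \<beta>))"
proof -
  have "((\<lambda>t. 1 / (1 - t)) \<longlongrightarrow> 1 / (1 - 1 / \<beta>)) (at_left (1 / \<beta>))"
    by (intro tendsto_intros) (use \<beta> in auto)
  then show ?thesis
    by (rule tendsto_divide_0[OF _ filterlim_at_top_imp_at_infinity[OF gen_at_top]])
qed

section \<open>The scaling function psi: existence and continuity\<close>

lemma conformal_function_exists:
  obtains \<psi> where "mono_on {a..b} \<psi>" "\<psi> a = 0" "\<psi> b = 1"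
    "\<forall>J\<in>D. \<forall>x\<in>J. \<forall>y\<in>J. \<bar>\<psi> (branch f J x) - \<psi> (branch f J y)\<bar> = \<beta> * \<bar>\<psi> x - \<psi> y\<bar>"
proof -
  let ?H = "at_left (1 / \<beta>)"
  \<comment> \<open>Clamping provides the bounds that \<open>convergent_refinement\<close> wants for
    all \<open>t\<close> and \<open>x\<close>; for admissible \<open>t\<close> with
    \<open>gen t a b\<close> positive and \<open>x\<close> in \<open>[a, b]\<close> it changes
    nothing.\<close>
  define \<Psi> where "\<Psi> t x = min 1 (max 0 (gen t a x / gen t a b))" for t x
  have "\<Psi> t x \<in> {0..1}" for t x by (auto simp: \<Psi>_def)
  then obtain G \<psi> where G: "G \<noteq> bot" "G \<le> ?H" and lim: "\<And>x. ((\<lambda>t. \<Psi> t x) \<longlongrightarrow> \<psi> x) G"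
    using convergent_refinement[of ?H \<Psi> 0 1] trivial_limit_at_left_real by metis
  have err: "((\<lambda>t. (1 / (1 - t)) / gen t a b) \<longlongrightarrow> 0) G"
    using tendsto_mono[OF G(2) error_tendsto_zero] .
  have "\<forall>\<^sub>F t in ?H. 0 < gen t a b"
    using gen_at_top unfolding filterlim_at_top_dense by blast
  then have ev: "\<forall>\<^sub>F t in G. admissible t \<and> 0 < gen t a b"
    using eventually_admissible filter_leD[OF G(2)] by (simp add: eventually_conj)
  have \<Psi>: "\<Psi> t x = gen t a x / gen t a b"
    if "admissible t \<and> 0 < gen t a b" "x \<in> {a..b}" for t x
    using that gen_nonneg[of t a x] gen_mono[of t a x b] by (simp add: \<Psi>_def)
  \<comment> \<open>Approximate additivity identifies the increments of \<open>\<psi>\<close> as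
    limits of \<open>gen t x y\<close>; monotonicity and scaling are both read off from
    this.\<close>
  have diff: "((\<lambda>t. gen t x y / gen t a b) \<longlongrightarrow> \<psi> y - \<psi> x) G"
    if xy: "a \<le> x" "x \<le> y" "y \<le> b" for x y
  proof (rule tendsto_of_error[OF tendsto_diff[OF lim lim] err])
    show "\<forall>\<^sub>F t in G. \<bar>gen t x y / gen t a b - (\<Psi> t y - \<Psi> t x)\<bar> \<le> (1 / (1 - t)) / gen t a b"
      using ev
    proof eventually_elim
      case (elim t)
      have "gen t x y / gen t a b - (\<Psi> t y - \<Psi> t x) = (gen t x y - (gen t a y - gen t a x)) / gen t a b"
        using \<Psi>[OF elim] xy by (simp add: diff_divide_distrib)
      moreover have "\<bar>gen t x y - (gen t a y - gen t a x)\<bar> \<le> 1 / (1 - t)"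
        using gen_add[of t a x y] elim xy by linarith
      ultimately show ?case
        using elim by (metis abs_divide_le)
    qed
  qed
  have t_lim: "((\<lambda>t. t) \<longlongrightarrow> 1 / \<beta>) G"
    using tendsto_mono[OF G(2) tendsto_ident_at] .
  have mono: "\<psi> x \<le> \<psi> y" if "a \<le> x" "x \<le> y" "y \<le> b" for x y
  proof -
    have "\<forall>\<^sub>F t in G. 0 \<le> gen t x y / gen t a b"
      using ev by eventually_elim (use that gen_nonneg in auto)
    then have "0 \<le> \<psi> y - \<psi> x" using diff[OF that] G(1) by (intro tendsto_lowerbound)
    then show ?thesis by simp
  qed
  have scale: "\<bar>\<psi> (branch f J x) - \<psi> (branch f J y)\<bar> = \<beta> * \<bar>\<psi> x - \<psi> y\<bar>"
    if J: "J \<in> D" "x \<in> J" "y \<in> J" "x \<le> y" for J x y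
  proof -
    define p where "p = min (branch f J x) (branch f J y)"
    define q where "q = max (branch f J x) (branch f J y)"
    have "branch f J x \<in> {a..b}" "branch f J y \<in> {a..b}" using J branch_range by blast+
    then have pq: "a \<le> p" "p \<le> q" "q \<le> b" by (auto simp: p_def q_def)
    have xy: "a \<le> x" "x \<le> y" "y \<le> b" using lap_subset[OF J(1)] J by auto
    have "((\<lambda>t. gen t x y / gen t a b) \<longlongrightarrow> 1 / \<beta> * (\<psi> q - \<psi> p)) G"
    proof (rule tendsto_of_error[OF tendsto_mult[OF t_lim diff[OF pq]] err])
      show "\<forall>\<^sub>F t in G. \<bar>gen t x y / gen t a b - t * (gen t p q / gen t a b)\<bar> \<le> (1 / (1 - t)) / gen t a b"
        using ev
      proof eventually_elim
        case (elim t)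
        have "gen t x y / gen t a b - t * (gen t p q / gen t a b) = (gen t x y - t * gen t p q) / gen t a b"
          by (simp add: diff_divide_distrib)
        moreover have "\<bar>gen t x y - t * gen t p q\<bar> \<le> 1 / (1 - t)"
          using gen_branch[of t, OF _ J] elim unfolding p_def q_def by linarith
        ultimately show ?case
          using elim by (metis abs_divide_le)
      qed
    qed
    then have "\<psi> y - \<psi> x = 1 / \<beta> * (\<psi> q - \<psi> p)"
      using tendsto_unique[OF G(1) diff[OF xy]] by blast
    then have "\<psi> q - \<psi> p = \<beta> * (\<psi> y - \<psi> x)" using \<beta> by (simp add: field_simps)
    moreover have "\<psi> q - \<psi> p = \<bar>\<psi> (branch f J x) - \<psi> (branch f J y)\<bar>"
      using mono[OF pq] unfolding p_def q_def by (cases "branch f J x \<le> branch f J y") auto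
    moreover have "\<bar>\<psi> x - \<psi> y\<bar> = \<psi> y - \<psi> x" using mono[OF xy] by simp
    ultimately show ?thesis by simp
  qed
  show ?thesis
  proof (rule that)
    show "mono_on {a..b} \<psi>" using mono by (auto intro: monotone_onI)
    have "((\<lambda>t. \<Psi> t a) \<longlongrightarrow> 0) G" by (simp add: \<Psi>_def gen_def)
    with lim[of a] show "\<psi> a = 0" by (rule tendsto_unique[OF G(1)])
    have "((\<lambda>t. \<Psi> t b) \<longlongrightarrow> 1) G"
      by (rule tendsto_eventually, use ev in eventually_elim) (use \<Psi> ab in auto)
    with lim[of b] show "\<psi> b = 1" by (rule tendsto_unique[OF G(1)])
    show "\<forall>J\<in>D. \<forall>x\<in>J. \<forall>y\<in>J. \<bar>\<psi> (branch f J x) - \<psi> (branch f J y)\<bar> = \<beta> * \<bar>\<psi> x - \<psi> y\<bar>"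
    proof (intro ballI)
      fix J x y assume J: "J \<in> D" "x \<in> J" "y \<in> J"
      consider "x \<le> y" | "y \<le> x" by linarith
      then show "\<bar>\<psi> (branch f J x) - \<psi> (branch f J y)\<bar> = \<beta> * \<bar>\<psi> x - \<psi> y\<bar>"
      proof cases
        case 1
        then show ?thesis by (rule scale[OF J])
      next
        case 2
        from scale[OF J(1,3,2) 2] show ?thesis by (simp only: abs_minus_commute)
      qed
    qed
  qed
qed

text \<open>A pointwise limit of monotone functions may jump. Here a jump would be
  \<open>\<beta>\<close> times as large at the image of the point, and after enough steps exceed the
  total increase 1. The induction bounds the oscillation at all points at once, since step
  \<open>n + 1\<close> at \<open>x\<close> uses step \<open>n\<close> at the images of
  \<open>x\<close>.\<close>

lemma conformal_function_continuous:
  assumes mono: "mono_on {a..b} \<psi>" and "\<psi> a = 0" "\<psi> b = 1"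
    and scale: "\<And>J x y. J \<in> D \<Longrightarrow> x \<in> J \<Longrightarrow> y \<in> J \<Longrightarrow>
      \<bar>\<psi> (branch f J x) - \<psi> (branch f J y)\<bar> = \<beta> * \<bar>\<psi> x - \<psi> y\<bar>"
  shows "continuous_on {a..b} \<psi>"
proof -
  have range: "\<psi> x \<in> {0..1}" if "x \<in> {a..b}" for x
    using mono that assms(2,3) ab unfolding monotone_on_def by (metis atLeastAtMost_iff less_imp_le order_refl)
  have osc: "\<forall>x\<in>{a..b}. \<exists>d>0. \<forall>y\<in>{a..b}. dist y x < d \<longrightarrow> \<bar>\<psi> y - \<psi> x\<bar> \<le> (1 / \<beta>) ^ n" for n
  proof (induction n)
    case 0
    have "\<bar>\<psi> y - \<psi> x\<bar> \<le> 1" if "x \<in> {a..b}" "y \<in> {a..b}" for x y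
      using range[OF that(1)] range[OF that(2)] by auto
    then show ?case by (auto intro: exI[of _ 1])
  next
    case (Suc n)
    show ?case
    proof
      fix x assume x: "x \<in> {a..b}"
      \<comment> \<open>Each lap gets its own radius: a lap through \<open>x\<close> by the scaling
        relation, any other because it is closed and misses \<open>x\<close>.\<close>
      have "\<exists>d>0. \<forall>y\<in>J. dist y x < d \<longrightarrow> \<bar>\<psi> y - \<psi> x\<bar> \<le> (1 / \<beta>) ^ Suc n" if J: "J \<in> D" for J
      proof (cases "x \<in> J")
        case True
        have "branch f J x \<in> {a..b}" using branch_range[OF J] True by blast
        then obtain e where e: "e > 0"
          "\<And>z. z \<in> {a..b} \<Longrightarrow> dist z (branch f J x) < e \<Longrightarrow> \<bar>\<psi> z - \<psi> (branch f J x)\<bar> \<le> (1 / \<beta>) ^ n"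
          using Suc.IH by blast
        obtain d where d: "d > 0" "\<And>y. y \<in> J \<Longrightarrow> dist y x < d \<Longrightarrow> dist (branch f J y) (branch f J x) < e"
          using branch_continuous[OF J] True e(1) unfolding continuous_on_iff by metis
        have "\<bar>\<psi> y - \<psi> x\<bar> \<le> (1 / \<beta>) ^ Suc n" if y: "y \<in> J" "dist y x < d" for y
        proof -
          have "branch f J y \<in> {a..b}" using branch_range[OF J] y(1) by blast
          then have "\<beta> * \<bar>\<psi> y - \<psi> x\<bar> \<le> (1 / \<beta>) ^ n"
            using e(2)[OF _ d(2)[OF y]] scale[OF J y(1) True] by metis
          then show ?thesis using \<beta> by (simp add: field_simps)
        qed
        then show ?thesis using d(1) by blast
      next
        case False
        then obtain d where "d > 0" "\<And>y. y \<in> J \<Longrightarrow> d \<le> dist x y"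
          using separate_point_closed[OF closed_lap[OF J]] by blast
        then show ?thesis by (intro exI[of _ d]) (auto simp: dist_commute not_less[symmetric])
      qed
      then obtain d where d: "\<And>J. J \<in> D \<Longrightarrow> d J > 0"
        "\<And>J y. J \<in> D \<Longrightarrow> y \<in> J \<Longrightarrow> dist y x < d J \<Longrightarrow> \<bar>\<psi> y - \<psi> x\<bar> \<le> (1 / \<beta>) ^ Suc n"
        by metis
      have "D \<noteq> {}" using cover x by auto
      define e where "e = Min (d ` D)"
      have e: "e > 0" using d(1) finite_D \<open>D \<noteq> {}\<close> by (auto simp: e_def)
      have "\<bar>\<psi> y - \<psi> x\<bar> \<le> (1 / \<beta>) ^ Suc n" if y: "y \<in> {a..b}" "dist y x < e" for y
      proof -
        from y(1) have "y \<in> \<Union>D" by (simp add: cover)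
        then obtain J where J: "J \<in> D" "y \<in> J" by (rule UnionE)
        then have "e \<le> d J" using finite_D by (simp add: e_def)
        then show ?thesis using d(2)[OF J] y(2) by simp
      qed
      then show "\<exists>d>0. \<forall>y\<in>{a..b}. dist y x < d \<longrightarrow> \<bar>\<psi> y - \<psi> x\<bar> \<le> (1 / \<beta>) ^ Suc n"
        using e by blast
    qed
  qed
  show ?thesis
    unfolding continuous_on_iff
  proof (intro ballI allI impI)
    fix x e :: real assume x: "x \<in> {a..b}" and e: "0 < e"
    obtain n where n: "(1 / \<beta>) ^ n < e" using real_arch_pow_inv[OF e, of "1 / \<beta>"] \<beta> by auto
    obtain d where "d > 0" "\<And>y. y \<in> {a..b} \<Longrightarrow> dist y x < d \<Longrightarrow> \<bar>\<psi> y - \<psi> x\<bar> \<le> (1 / \<beta>) ^ n"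
      using osc[of n] x by blast
    then show "\<exists>d>0. \<forall>y\<in>{a..b}. dist y x < d \<longrightarrow> dist (\<psi> y) (\<psi> x) < e"
      using n by (intro exI[of _ d]) (force simp: dist_real_def)
  qed
qed

end

subsection \<open>The map of constant slope\<close>

text \<open>The gaps form an open set, and a finite open set of reals is empty.\<close>

lemma cover_if_finite_gaps:
  fixes U :: "real set"
  assumes "closed U" "finite ({x<..<y} - U)" "x < y"
  shows "{x..y} \<subseteq> U"
proof -
  have "open ({x<..<y} - U)" using assms(1) by (intro open_Diff) auto
  then have "{x<..<y} - U = {}" using finite_imp_not_open[OF assms(2)] by blast
  then have "closure {x<..<y} \<subseteq> U" using assms(1) by (intro closure_minimal) auto
  then show ?thesis using assms(3) by simp
qed

context positive_entropy begin

text \<open>In terms of the values of \<open>\<psi>\<close> each branch is affine, the sign of its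
  slope being its direction. Laps that \<open>\<psi>\<close> collapses contribute no piece to
  \<open>g\<close>; their images are finitely many points, so the remaining images still cover
  \<open>[0, 1]\<close>.\<close>

lemma constant_slope_semiconjugacy:
  "\<exists>g \<psi>. g \<in> constant_slope_maps \<beta> \<and>
     continuous_on {a..b} \<psi> \<and> mono_on {a..b} \<psi> \<and> \<psi> ` {a..b} = {0..1} \<and>
     compatible f D \<psi> \<and> semiconjugates \<psi> f D g"
proof -
  obtain \<psi> where mono: "mono_on {a..b} \<psi>" and \<psi>a: "\<psi> a = 0" and \<psi>b: "\<psi> b = 1"
    and scale': "\<forall>J\<in>D. \<forall>x\<in>J. \<forall>y\<in>J.
      \<bar>\<psi> (branch f J x) - \<psi> (branch f J y)\<bar> = \<beta> * \<bar>\<psi> x - \<psi> y\<bar>"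
    by (rule conformal_function_exists)
  have scale: "\<bar>\<psi> (branch f J x) - \<psi> (branch f J y)\<bar> = \<beta> * \<bar>\<psi> x - \<psi> y\<bar>"
    if "J \<in> D" "x \<in> J" "y \<in> J" for J x y
    using scale' that by blast
  have cont: "continuous_on {a..b} \<psi>"
    by (rule conformal_function_continuous[OF mono \<psi>a \<psi>b scale])
  have le: "\<psi> x \<le> \<psi> y" if "a \<le> x" "x \<le> y" "y \<le> b" for x y
    using mono that by (auto simp: monotone_on_def)
  have image: "\<psi> ` {u..v} = {\<psi> u..\<psi> v}" if uv: "a \<le> u" "u \<le> v" "v \<le> b" for u v
  proof (intro equalityI subsetI)
    fix y assume "y \<in> \<psi> ` {u..v}"
    then show "y \<in> {\<psi> u..\<psi> v}" using le uv by auto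
  next
    fix y assume y: "y \<in> {\<psi> u..\<psi> v}"
    have "continuous_on {u..v} \<psi>" by (rule continuous_on_subset[OF cont]) (use uv in auto)
    then have "\<exists>x. u \<le> x \<and> x \<le> v \<and> \<psi> x = y" using y uv by (intro IVT') auto
    then show "y \<in> \<psi> ` {u..v}" by auto
  qed
  have onto: "\<psi> ` {a..b} = {0..1}" using image[of a b] \<psi>a \<psi>b ab by simp
  then have range: "\<psi> x \<in> {0..1}" if "x \<in> {a..b}" for x using that by blast
  have affine: "\<exists>m c. \<bar>m\<bar> = \<beta> \<and> (\<forall>x\<in>J. \<psi> (branch f J x) = m * \<psi> x + c)" if J: "J \<in> D" for J
  proof -
    obtain u v where uv: "J = {u..v}" "u < v" "a \<le> u" "v \<le> b" using lap_interval[OF J] .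
    let ?h = "branch f J"
    have h: "?h x \<in> {a..b}" if "x \<in> J" for x using branch_range[OF J] that by blast
    have u: "u \<in> J" using uv by simp
    from branch_monotonic[OF J] consider "mono_on J ?h" | "antimono_on J ?h"
      unfolding monotonic_on_def by blast
    then show ?thesis
    proof cases
      case 1
      have "\<psi> (?h x) = \<beta> * \<psi> x + (\<psi> (?h u) - \<beta> * \<psi> u)" if x: "x \<in> J" for x
      proof -
        have "u \<le> x" "x \<le> b" using x uv by auto
        moreover from this have "?h u \<le> ?h x" using 1 u x by (auto simp: monotone_on_def)
        ultimately have "\<psi> u \<le> \<psi> x" "\<psi> (?h u) \<le> \<psi> (?h x)"
          using le uv h[OF u] h[OF x] by auto
        then show ?thesis using scale[OF J x u] by (simp add: algebra_simps)
      qed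
      then show ?thesis using \<beta> by (intro exI[of _ \<beta>] exI) auto
    next
      case 2
      have "\<psi> (?h x) = (- \<beta>) * \<psi> x + (\<psi> (?h u) + \<beta> * \<psi> u)" if x: "x \<in> J" for x
      proof -
        have "u \<le> x" "x \<le> b" using x uv by auto
        moreover from this have "?h x \<le> ?h u" using 2 u x by (auto simp: monotone_on_def)
        ultimately have "\<psi> u \<le> \<psi> x" "\<psi> (?h x) \<le> \<psi> (?h u)"
          using le uv h[OF u] h[OF x] by auto
        then show ?thesis using scale[OF J x u] by (simp add: algebra_simps)
      qed
      then show ?thesis using \<beta> by (intro exI[of _ "- \<beta>"] exI) auto
    qed
  qed
  then obtain m c where m: "\<And>J. J \<in> D \<Longrightarrow> \<bar>m J\<bar> = \<beta>"
    and mc: "\<And>J x. J \<in> D \<Longrightarrow> x \<in> J \<Longrightarrow> \<psi> (branch f J x) = m J * \<psi> x + c J"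
    by metis
  define k where "k J y = m J * y + c J" for J y
  have k_range: "k J y \<in> {0..1}" if "J \<in> D" "y \<in> \<psi> ` J" for J y
    using that mc range branch_range unfolding k_def by (metis imageE image_subset_iff)
  have disj: "interior (\<psi> ` J) \<inter> interior (\<psi> ` J') = {}" if J: "J \<in> D" "J' \<in> D" "J \<noteq> J'" for J J'
  proof -
    obtain u v where uv: "J = {u..v}" "u < v" "a \<le> u" "v \<le> b" using lap_interval[OF J(1)] .
    obtain u' v' where uv': "J' = {u'..v'}" "u' < v'" "a \<le> u'" "v' \<le> b" using lap_interval[OF J(2)] .
    have "v \<le> u' \<or> v' \<le> u"
    proof (rule ccontr)
      assume "\<not> (v \<le> u' \<or> v' \<le> u)"
      then have "max u u' < min v v'" using uv(2) uv'(2) by auto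
      then obtain r where "max u u' < r" "r < min v v'" using dense by blast
      then have "r \<in> interior J \<inter> interior J'" using uv(1) uv'(1) by simp
      then show False using laps_disjoint[OF J] by blast
    qed
    then have "\<psi> v \<le> \<psi> u' \<or> \<psi> v' \<le> \<psi> u" using le[of v u'] le[of v' u] uv uv' by auto
    then show ?thesis using image[of u v] image[of u' v'] uv uv' by auto
  qed
  \<comment> \<open>Images of distinct laps have disjoint interiors, so the choice is unique. Within
    \<open>[0, 1]\<close> the default 0 concerns only endpoints of such images and keeps
    \<open>g\<close> inside \<open>[0, 1]\<close>.\<close>
  define g where "g y = (if \<exists>J\<in>D. y \<in> interior (\<psi> ` J)
    then k (SOME J. J \<in> D \<and> y \<in> interior (\<psi> ` J)) y else 0)" for y
  have g: "g y = k J y" if J: "J \<in> D" "y \<in> interior (\<psi> ` J)" for J y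
  proof -
    let ?J = "SOME J. J \<in> D \<and> y \<in> interior (\<psi> ` J)"
    have "?J \<in> D \<and> y \<in> interior (\<psi> ` ?J)" by (rule someI[of _ J]) (use J in blast)
    then have "?J = J" using disj[of ?J J] J by blast
    then show ?thesis using J unfolding g_def by auto
  qed
  define D' where "D' = {K \<in> (`) \<psi> ` D. interior K \<noteq> {}}"
  have D'E: "\<exists>J p q. J \<in> D \<and> K = \<psi> ` J \<and> K = {p..q} \<and> p < q" if K: "K \<in> D'" for K
  proof -
    obtain J where J: "J \<in> D" "K = \<psi> ` J" "interior K \<noteq> {}" using K unfolding D'_def by blast
    obtain u v where uv: "J = {u..v}" "u < v" "a \<le> u" "v \<le> b" using lap_interval[OF J(1)] .
    have "K = {\<psi> u..\<psi> v}" using image[of u v] uv J(2) by simp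
    moreover from this have "\<psi> u < \<psi> v" using J(3) by simp
    ultimately show ?thesis using J by blast
  qed
  have union: "\<Union>D' = {0..1}"
  proof
    show "\<Union>D' \<subseteq> {0..1}"
      using onto lap_subset unfolding D'_def by blast
    show "{0..1} \<subseteq> \<Union>D'"
    proof (rule cover_if_finite_gaps)
      show "closed (\<Union>D')"
      proof (rule closed_Union)
        show "finite D'" unfolding D'_def using finite_D by simp
        show "\<forall>K\<in>D'. closed K" using D'E by (metis closed_atLeastAtMost)
      qed
      have "finite (\<psi> ` J)" if J: "J \<in> D" "interior (\<psi> ` J) = {}" for J
      proof -
        obtain u v where uv: "J = {u..v}" "u < v" "a \<le> u" "v \<le> b" using lap_interval[OF J(1)] .
        have "\<psi> ` J = {\<psi> u..\<psi> v}" using image[of u v] uv by simp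
        moreover from this have "\<psi> v \<le> \<psi> u" using J(2) by (simp add: not_less[symmetric])
        moreover have "\<psi> u \<le> \<psi> v" using le uv by simp
        ultimately show ?thesis by simp
      qed
      then have "finite (\<Union>J\<in>{J \<in> D. interior (\<psi> ` J) = {}}. \<psi> ` J)"
        using finite_D by auto
      moreover have "{0<..<1} - \<Union>D' \<subseteq> (\<Union>J\<in>{J \<in> D. interior (\<psi> ` J) = {}}. \<psi> ` J)"
      proof
        fix y :: real assume y: "y \<in> {0<..<1} - \<Union>D'"
        then have "y \<in> \<psi> ` \<Union>D" unfolding cover onto by simp
        then obtain J where "J \<in> D" "y \<in> \<psi> ` J" by blast
        moreover from this have "interior (\<psi> ` J) = {}" using y unfolding D'_def by blast
        ultimately show "y \<in> (\<Union>J\<in>{J \<in> D. interior (\<psi> ` J) = {}}. \<psi> ` J)" by blast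
      qed
      ultimately show "finite ({0<..<1} - \<Union>D')" by (rule rev_finite_subset)
    qed simp
  qed
  have division: "interval_division D' 0 1"
    unfolding interval_division_def division_of_def
  proof (intro conjI ballI impI)
    show "finite D'" unfolding D'_def using finite_D by simp
    show "\<Union>D' = {0..1}" by (rule union)
    fix K assume K: "K \<in> D'"
    then show "K \<subseteq> {0..1}" using union by blast
    show "interior K \<noteq> {}" using K unfolding D'_def by blast
    then show "K \<noteq> {}" by auto
    show "\<exists>a b. K = cbox a b" using D'E[OF K] by (auto simp: cbox_interval)
    fix K' assume "K' \<in> D'" "K \<noteq> K'"
    then show "interior K \<inter> interior K' = {}"
      using K disj unfolding D'_def by blast
  qed
  have affine_g: "\<exists>\<mu> d. \<bar>\<mu>\<bar> = \<beta> \<and> (\<forall>y\<in>interior K. g y = \<mu> * y + d)" if K: "K \<in> D'" for K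
    using K g m unfolding D'_def k_def by blast
  have "g y \<in> {0..1}" for y
  proof (cases "\<exists>J\<in>D. y \<in> interior (\<psi> ` J)")
    case True
    then obtain J where "J \<in> D" "y \<in> interior (\<psi> ` J)" by blast
    then show ?thesis using g k_range interior_subset by (metis subsetD)
  next
    case False
    then have "g y = 0" by (simp only: g_def if_False)
    then show ?thesis by simp
  qed
  moreover have "continuous_monotone_inside g K" if K: "K \<in> D'" for K
  proof -
    obtain \<mu> d where \<mu>: "\<And>y. y \<in> interior K \<Longrightarrow> g y = \<mu> * y + d" using affine_g[OF K] by blast
    have "continuous_on (interior K) (\<lambda>y. \<mu> * y + d)" by (intro continuous_intros)
    then have "continuous_on (interior K) g" using \<mu> by (simp cong: continuous_on_cong)
    moreover have "monotonic_on (interior K) g"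
    proof (cases "\<mu> \<ge> 0")
      case True
      then show ?thesis using \<mu> by (simp add: monotonic_on_def monotone_on_def mult_left_mono)
    next
      case False
      then show ?thesis using \<mu> by (simp add: monotonic_on_def monotone_on_def mult_left_mono_neg)
    qed
    ultimately show ?thesis unfolding continuous_monotone_inside_def by simp
  qed
  ultimately have pm: "pc_pm_map 0 1 g"
    unfolding pc_pm_map_def using division by (intro conjI exI[of _ D']) auto
  \<comment> \<open>At an endpoint of a piece \<open>g\<close> may have the default value 0.
    Differentiability makes \<open>g\<close> continuous there, which forces the value of the affine
    formula; the difference quotient from inside one piece is then constant.\<close>
  have slope: "\<bar>\<nu>\<bar> = \<beta>" if y: "y \<in> {0..1}" and der: "(g has_real_derivative \<nu>) (at y within {0..1})" for y \<nu>
  proof -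
    obtain K where K: "K \<in> D'" "y \<in> K" using y unfolding union[symmetric] by blast
    obtain p q where pq: "K = {p..q}" "p < q" using D'E[OF K(1)] by blast
    obtain \<mu> d where \<mu>: "\<bar>\<mu>\<bar> = \<beta>" "\<And>z. z \<in> {p<..<q} \<Longrightarrow> g z = \<mu> * z + d"
      using affine_g[OF K(1)] pq(1) by auto
    let ?F = "at y within {p<..<q}"
    have F: "?F \<noteq> bot" using at_within_Ioo_neq_bot[OF pq(2)] K(2) pq(1) by simp
    have sub: "{p<..<q} \<subseteq> {0..1}"
    proof -
      have "K \<subseteq> {0..1}" using K(1) union by blast
      moreover have "{p<..<q} \<subseteq> K" unfolding pq(1) by auto
      ultimately show ?thesis by (rule subset_trans[rotated])
    qed
    have der': "(g has_real_derivative \<nu>) ?F" by (rule has_field_derivative_subset[OF der sub])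
    have ev: "\<forall>\<^sub>F z in ?F. z \<noteq> y \<and> g z = \<mu> * z + d"
      using \<mu>(2) by (auto simp: eventually_at_filter)
    have "(g \<longlongrightarrow> g y) ?F"
      using DERIV_continuous[OF der'] by (simp add: continuous_within)
    moreover have "(g \<longlongrightarrow> \<mu> * y + d) ?F"
    proof (rule Lim_transform_eventually)
      show "((\<lambda>z. \<mu> * z + d) \<longlongrightarrow> \<mu> * y + d) ?F" by (intro tendsto_intros)
      show "\<forall>\<^sub>F z in ?F. \<mu> * z + d = g z" using ev by eventually_elim simp
    qed
    ultimately have gy: "g y = \<mu> * y + d" using tendsto_unique[OF F] by blast
    have "((\<lambda>z. (g z - g y) / (z - y)) \<longlongrightarrow> \<nu>) ?F"
      using der' by (simp add: has_field_derivative_iff)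
    moreover have "((\<lambda>z. (g z - g y) / (z - y)) \<longlongrightarrow> \<mu>) ?F"
    proof (rule tendsto_eventually)
      show "\<forall>\<^sub>F z in ?F. (g z - g y) / (z - y) = \<mu>"
        using ev
      proof eventually_elim
        case (elim z)
        then have "g z - g y = \<mu> * (z - y)" by (simp add: gy algebra_simps)
        then show ?case using elim by simp
      qed
    qed
    ultimately have "\<nu> = \<mu>" using tendsto_unique[OF F] by blast
    then show ?thesis using \<mu>(1) by simp
  qed
  have "\<exists>m c. \<forall>x\<in>interior K. g x = m * x + c" if "K \<in> D'" for K
    using affine_g[OF that] by blast
  then have "g \<in> constant_slope_maps \<beta>"
    unfolding constant_slope_maps_def using pm division slope by blast
  moreover have point: "is_singleton (\<psi> ` branch f J ` J)" if J: "J \<in> D" "is_singleton (\<psi> ` J)" for J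
  proof -
    obtain r where r: "\<psi> ` J = {r}" using J(2) by (rule is_singletonE)
    then have "\<psi> (branch f J x) = m J * r + c J" if "x \<in> J" for x
      using mc[OF J(1) that] that by auto
    moreover have "J \<noteq> {}" using r by auto
    moreover have "\<psi> ` branch f J ` J = (\<lambda>_. m J * r + c J) ` J"
      unfolding image_image by (rule image_cong) (simp_all add: calculation)
    ultimately have "\<psi> ` branch f J ` J = {m J * r + c J}"
      by (simp add: image_constant_conv)
    then show ?thesis by simp
  qed
  moreover have "semiconjugates \<psi> f D g"
    unfolding semiconjugates_def
  proof (intro ballI conjI impI)
    fix J assume J: "J \<in> D"
    show "is_singleton (\<psi> ` branch f J ` J)" if "is_singleton (\<psi> ` J)" using point[OF J that] .
    \<comment> \<open>The affine map \<open>k J\<close> is at every point the limit of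
      \<open>g\<close> from inside psi(J), so it meets the endpoint condition whatever value
      \<open>g\<close> has there.\<close>
    have "(g \<longlongrightarrow> k J y) (at y within interior (\<psi> ` J))" for y
    proof (rule Lim_transform_eventually)
      show "(k J \<longlongrightarrow> k J y) (at y within interior (\<psi> ` J))"
        unfolding k_def by (intro tendsto_intros)
      show "\<forall>\<^sub>F z in at y within interior (\<psi> ` J). k J z = g z"
        using g[OF J] by (auto simp: eventually_at_filter)
    qed
    then show "\<exists>gJ. gJ \<in> \<psi> ` J \<rightarrow> {0..1} \<and> (\<forall>y\<in>interior (\<psi> ` J). gJ y = g y) \<and>
        (\<forall>y\<in>\<psi> ` J. gJ y = g y \<or> (g \<longlongrightarrow> gJ y) (at y within interior (\<psi> ` J))) \<and>
        (\<forall>x\<in>J. \<psi> (branch f J x) = gJ (\<psi> x))"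
      using k_range[OF J] g[OF J] mc[OF J] by (intro exI[of _ "k J"]) (simp add: k_def)
  qed
  ultimately show ?thesis
    using cont mono onto unfolding compatible_def by blast
qed

end

theorem theorem1:
  fixes a b \<beta> :: real and f :: "real \<Rightarrow> real" and D :: "real set set"
  assumes "a < b"
    and "pc_pm_map a b f"
    and "laps a b f D"
    and "0 < \<beta>"
    and "topological_entropy a b f D = ln \<beta>"
    and "0 < topological_entropy a b f D"
  shows "\<exists>g \<psi>. g \<in> constant_slope_maps \<beta> \<and>
           continuous_on {a..b} \<psi> \<and> mono_on {a..b} \<psi> \<and> \<psi> ` {a..b} = {0..1} \<and>
           compatible f D \<psi> \<and> semiconjugates \<psi> f D g"
proof -
  \<comment> \<open>A lap is a shortened maximal interval and inherits continuity and monotonicity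
    from it.\<close>
  have "continuous_monotone_inside f J" if "J \<in> D" for J
  proof -
    from assms(3)[unfolded laps_def, THEN conjunct2]
    obtain M where M: "bij_betw M D (maximal_intervals a b (continuous_monotone_inside f))"
        "\<forall>J\<in>D. J \<subseteq> M J"
      by (elim exE conjE)
    have "M J \<in> maximal_intervals a b (continuous_monotone_inside f)"
      by (rule bij_betw_apply[OF M(1) that])
    then have "continuous_monotone_inside f (M J)"
      unfolding maximal_intervals_def Let_def by (elim CollectE conjE exE) simp
    moreover have "interior J \<subseteq> interior (M J)"
      using M(2) that by (intro interior_mono) blast
    ultimately show ?thesis
      unfolding continuous_monotone_inside_def monotonic_on_def
      by (meson continuous_on_subset monotone_on_subset)
  qed
  moreover have "1 < \<beta>" using assms(4-6) by simp
  ultimately interpret positive_entropy a b f D \<beta>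
    using assms by unfold_locales (auto simp: pc_pm_map_def laps_def)
  show ?thesis by (rule constant_slope_semiconjugacy)
qed


end
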